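(* Let $\mathbb{F}$ be an algebraically closed field of characteristic $0$, $\mathsf{R}=\mathbb{F}[x]$, and $0\neq h\in\mathsf{R}$. Let $\mathsf{V}=\mathsf{V}^{\mathfrak{m}}$ be an irreducible generalized weight module for $\mathsf{A}_h$, where $\mathfrak{m}=\mathsf{R}f$ is a maximal ideal of $\mathsf{R}$ with $f$ a monic prime polynomial. Either (i) $f=x-\lambda$, where $\lambda$ is a root of $h$, and $\mathsf{V}\cong\mathsf{V}_{\lambda,\mu}$ for some $\mu\in\mathbb{F}$, where $\mathsf{V}_{\lambda,\mu}=\mathbb{F}v_{\lambda,\mu}$ is the one-dimensional $\mathsf{A}_h$-module with $x.v_{\lambda,\mu}=\lambda v_{\lambda,\mu}$ and $y.v_{\lambda,\mu}=\mu v_{\lambda,\mu}$; or (ii) $f$ is not a factor of $h$ and $\mathsf{V}$ is isomorphic to the induced module $\mathsf{U}(\mathfrak{m})=\mathsf{A}_h\otimes_{\mathsf{R}}\mathsf{R}/\mathfrak{m}$.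
   Context: $\mathsf{A}_h$ is the unital associative $\mathbb{F}$-algebra with generators $x,y$ and defining relation $yx=xy+h$; throughout $h\neq 0$. It contains $\mathsf{R}=\mathbb{F}[x]$ as a subalgebra. Modules are left modules; "prime polynomial" means irreducible polynomial. For an $\mathsf{A}_h$-module $\mathsf{M}$ and an ideal $\mathfrak{n}$ of $\mathsf{R}$, let $\mathsf{M}^{\mathfrak{n}}=\{v\in\mathsf{M}\mid\mathfrak{n}^kv=0\text{ for some }k=k(v)\}$. $\mathsf{M}$ is a generalized weight module if $\mathsf{M}=\bigoplus_{\mathfrak{n}}\mathsf{M}^{\mathfrak{n}}$, the sum being over all maximal ideals $\mathfrak{n}$ of $\mathsf{R}$. *)

theory Defs
  imports "HOL-Algebra.Algebra" "HOL-Algebra.Algebraic_Closure_Type"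
begin

section \<open>The algebra A_h\<close>

datatype gen = GenX | GenY

text \<open>Words in the two generators, wrapped because lists are not an instance of
  \<^class>\<open>monoid_add\<close>; the additive structure below is concatenation.\<close>

datatype word = Word (letters: "gen list")

instantiation word :: monoid_add
begin

definition zero_word :: word where
  "0 = Word []"

definition plus_word :: "word \<Rightarrow> word \<Rightarrow> word" where
  "u + v = Word (letters u @ letters v)"

instance
  by standard (simp_all add: zero_word_def plus_word_def)

end

text \<open>The free unital associative algebra on the two generators is the monoid algebra of words,
  with the convolution product of \<^type>\<open>poly_mapping\<close>.\<close>

type_synonym 'a free_alg = "word \<Rightarrow>\<^sub>0 'a"

definition freeX :: "'a::field free_alg" where
  "freeX = Poly_Mapping.single (Word [GenX]) 1"

definition freeY :: "'a::field free_alg" where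
  "freeY = Poly_Mapping.single (Word [GenY]) 1"

definition free_of_poly :: "'a::field poly \<Rightarrow> 'a free_alg" where
  "free_of_poly p = (\<Sum>i\<le>Polynomial.degree p. Poly_Mapping.single (Word (replicate i GenX)) (Polynomial.coeff p i))"

definition rel_ideal :: "'a::field poly \<Rightarrow> 'a free_alg set" where
  "rel_ideal h = Idl\<^bsub>ring_of_type_algebra\<^esub> {freeY * freeX - (freeX * freeY + free_of_poly h)}"

type_synonym 'a Ah_elt = "'a free_alg set"

definition Ah :: "'a::field poly \<Rightarrow> 'a Ah_elt ring" where
  "Ah h = ring_of_type_algebra Quot rel_ideal h"

definition Ah_of_free :: "'a::field poly \<Rightarrow> 'a free_alg \<Rightarrow> 'a Ah_elt" where
  "Ah_of_free h p = rel_ideal h +>\<^bsub>ring_of_type_algebra\<^esub> p"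

abbreviation Ah_x :: "'a::field poly \<Rightarrow> 'a Ah_elt" where
  "Ah_x h \<equiv> Ah_of_free h freeX"

abbreviation Ah_y :: "'a::field poly \<Rightarrow> 'a Ah_elt" where
  "Ah_y h \<equiv> Ah_of_free h freeY"

abbreviation R_poly :: "'a::field poly ring" where
  "R_poly \<equiv> ring_of_type_algebra"

abbreviation Ah_of_poly :: "'a::field poly \<Rightarrow> 'a poly \<Rightarrow> 'a Ah_elt" where
  "Ah_of_poly h p \<equiv> Ah_of_free h (free_of_poly p)"


section \<open>Left modules over a ring that need not be commutative\<close>

text \<open>The library locale \<^locale>\<open>module\<close> requires a commutative ring of scalars; the axioms below
  are the same over a ring. The record is the library's, so its fields for a multiplication and
  a unit on the module itself are present but never used.\<close>

locale left_module = R?: ring R + M?: abelian_group M 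
  for R :: "('r, 'x) ring_scheme" and M :: "('r, 'v, 'y) module_scheme" (structure) +
  assumes smult_closed:
      "\<lbrakk>a \<in> carrier R; v \<in> carrier M\<rbrakk> \<Longrightarrow> a \<odot>\<^bsub>M\<^esub> v \<in> carrier M"
    and smult_l_distr:
      "\<lbrakk>a \<in> carrier R; b \<in> carrier R; v \<in> carrier M\<rbrakk> \<Longrightarrow>
       (a \<oplus>\<^bsub>R\<^esub> b) \<odot>\<^bsub>M\<^esub> v = a \<odot>\<^bsub>M\<^esub> v \<oplus>\<^bsub>M\<^esub> b \<odot>\<^bsub>M\<^esub> v"
    and smult_r_distr:
      "\<lbrakk>a \<in> carrier R; v \<in> carrier M; w \<in> carrier M\<rbrakk> \<Longrightarrow>
       a \<odot>\<^bsub>M\<^esub> (v \<oplus>\<^bsub>M\<^esub> w) = a \<odot>\<^bsub>M\<^esub> v \<oplus>\<^bsub>M\<^esub> a \<odot>\<^bsub>M\<^esub> w"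
    and smult_assoc:
      "\<lbrakk>a \<in> carrier R; b \<in> carrier R; v \<in> carrier M\<rbrakk> \<Longrightarrow>
       (a \<otimes>\<^bsub>R\<^esub> b) \<odot>\<^bsub>M\<^esub> v = a \<odot>\<^bsub>M\<^esub> (b \<odot>\<^bsub>M\<^esub> v)"
    and smult_one:
      "v \<in> carrier M \<Longrightarrow> \<one>\<^bsub>R\<^esub> \<odot>\<^bsub>M\<^esub> v = v"

definition irreducible_module ::
  "('r, 'x) ring_scheme \<Rightarrow> ('r, 'v, 'y) module_scheme \<Rightarrow> bool" where
  "irreducible_module A M \<longleftrightarrow> left_module A M \<and> carrier M \<noteq> {\<zero>\<^bsub>M\<^esub>} \<and>
     (\<forall>W. submodule W A M \<longrightarrow> W = {\<zero>\<^bsub>M\<^esub>} \<or> W = carrier M)"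

definition module_iso ::
  "('r, 'x) ring_scheme \<Rightarrow> ('r, 'v, 'y) module_scheme \<Rightarrow> ('r, 'w, 'z) module_scheme \<Rightarrow> bool" where
  "module_iso A M N \<longleftrightarrow> (\<exists>\<phi>. bij_betw \<phi> (carrier M) (carrier N) \<and>
     (\<forall>v\<in>carrier M. \<forall>w\<in>carrier M. \<phi> (v \<oplus>\<^bsub>M\<^esub> w) = \<phi> v \<oplus>\<^bsub>N\<^esub> \<phi> w) \<and>
     (\<forall>a\<in>carrier A. \<forall>v\<in>carrier M. \<phi> (a \<odot>\<^bsub>M\<^esub> v) = a \<odot>\<^bsub>N\<^esub> \<phi> v))"

text \<open>\<open>M\<close> is the internal direct sum of the subgroups \<open>N i\<close>: the summation map from the
  external direct sum (the families of finite support) is an isomorphism.\<close>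

definition internal_direct_sum ::
  "('r, 'v, 'y) module_scheme \<Rightarrow> 'i set \<Rightarrow> ('i \<Rightarrow> 'v set) \<Rightarrow> bool" where
  "internal_direct_sum M I N \<longleftrightarrow> (\<forall>i\<in>I. subgroup (N i) (add_monoid M)) \<and>
     (\<lambda>c. gfinprod (add_monoid M) c I)
       \<in> iso (sum_group I (\<lambda>i. (add_monoid M)\<lparr>carrier := N i\<rparr>)) (add_monoid M)"


section \<open>Generalized weight modules\<close>

text \<open>The powers of the ideal \<open>\<nn>\<close> are those of the library monoid of ideals, in which the product
  is the ideal product and the unit is the whole ring.\<close>

definition weight_space ::
  "'a::field poly \<Rightarrow> ('a Ah_elt, 'v, 'y) module_scheme \<Rightarrow> 'a poly set \<Rightarrow> 'v set" where
  "weight_space h M \<nn> = {v \<in> carrier M. \<exists>k::nat.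
     \<forall>r \<in> \<nn> [^]\<^bsub>ideals_set R_poly\<^esub> k. Ah_of_poly h r \<odot>\<^bsub>M\<^esub> v = \<zero>\<^bsub>M\<^esub>}"

definition generalized_weight_module ::
  "'a::field poly \<Rightarrow> ('a Ah_elt, 'v, 'y) module_scheme \<Rightarrow> bool" where
  "generalized_weight_module h M \<longleftrightarrow> left_module (Ah h) M \<and>
     internal_direct_sum M {\<nn>. maximalideal \<nn> R_poly} (weight_space h M)"


section \<open>The one-dimensional modules\<close>

text \<open>\<open>free_eval lam mu\<close> is the unital algebra homomorphism from the free algebra to the base field
  that sends the two generators to \<open>lam\<close> and \<open>mu\<close>. If \<open>lam\<close> is a root of \<open>h\<close>, it is constant on the
  cosets that make up \<open>Ah h\<close>; in that case only, the scalar action below is meaningful.\<close>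

fun gen_eval :: "'a \<Rightarrow> 'a \<Rightarrow> gen \<Rightarrow> 'a" where
  "gen_eval lam mu GenX = lam"
| "gen_eval lam mu GenY = mu"

definition free_eval :: "'a::field \<Rightarrow> 'a \<Rightarrow> 'a free_alg \<Rightarrow> 'a" where
  "free_eval lam mu p = (\<Sum>w\<in>Poly_Mapping.keys p.
     Poly_Mapping.lookup p w * prod_list (map (gen_eval lam mu) (letters w)))"

definition one_dim_module :: "'a::field \<Rightarrow> 'a \<Rightarrow> ('a Ah_elt, 'a) module" where
  "one_dim_module lam mu =
     ring.extend ring_of_type_algebra
       (module.fields (\<lambda>a c. the_elem (free_eval lam mu ` a) * c))"


section \<open>Induced modules\<close>

text \<open>For a ring homomorphism \<open>\<phi>\<close> from \<open>R\<close> to \<open>A\<close> and a left \<open>R\<close>-module \<open>N\<close>, the tensor product of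
  \<open>A\<close> (as a right \<open>R\<close>-module through \<open>\<phi>\<close>) and \<open>N\<close> over \<open>R\<close> is the quotient of the free abelian
  group on pairs by the subgroup generated by the following elements.\<close>

definition tensor_rels ::
  "('b, 'x) ring_scheme \<Rightarrow> ('r, 'y) ring_scheme \<Rightarrow> ('r \<Rightarrow> 'b) \<Rightarrow> ('r, 'n, 'z) module_scheme
     \<Rightarrow> ('b \<times> 'n \<Rightarrow>\<^sub>0 int) set" where
  "tensor_rels A R \<phi> N =
     {frag_of (a \<oplus>\<^bsub>A\<^esub> b, n) - frag_of (a, n) - frag_of (b, n) | a b n.
        a \<in> carrier A \<and> b \<in> carrier A \<and> n \<in> carrier N}
   \<union> {frag_of (a, n \<oplus>\<^bsub>N\<^esub> n') - frag_of (a, n) - frag_of (a, n') | a n n'.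
        a \<in> carrier A \<and> n \<in> carrier N \<and> n' \<in> carrier N}
   \<union> {frag_of (a \<otimes>\<^bsub>A\<^esub> \<phi> r, n) - frag_of (a, r \<odot>\<^bsub>N\<^esub> n) | a r n.
        a \<in> carrier A \<and> r \<in> carrier R \<and> n \<in> carrier N}"

definition tensor_free ::
  "('b, 'x) ring_scheme \<Rightarrow> ('r, 'n, 'z) module_scheme \<Rightarrow> ('b \<times> 'n \<Rightarrow>\<^sub>0 int) monoid" where
  "tensor_free A N = free_Abelian_group (carrier A \<times> carrier N)"

definition tensor_null ::
  "('b, 'x) ring_scheme \<Rightarrow> ('r, 'y) ring_scheme \<Rightarrow> ('r \<Rightarrow> 'b) \<Rightarrow> ('r, 'n, 'z) module_scheme
     \<Rightarrow> ('b \<times> 'n \<Rightarrow>\<^sub>0 int) set" where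
  "tensor_null A R \<phi> N = generate (tensor_free A N) (tensor_rels A R \<phi> N)"

definition induced_module ::
  "('b, 'x) ring_scheme \<Rightarrow> ('r, 'y) ring_scheme \<Rightarrow> ('r \<Rightarrow> 'b) \<Rightarrow> ('r, 'n, 'z) module_scheme
     \<Rightarrow> ('b, ('b \<times> 'n \<Rightarrow>\<^sub>0 int) set) module" where
  "induced_module A R \<phi> N =
     (let Q = tensor_free A N Mod tensor_null A R \<phi> N in
      \<lparr>carrier = carrier Q, monoid.mult = undefined, one = undefined,
       ring.zero = \<one>\<^bsub>Q\<^esub>, add = (\<lambda>s t. s \<otimes>\<^bsub>Q\<^esub> t),
       module.smult = (\<lambda>a t. \<Union>z\<in>t. tensor_null A R \<phi> N #>\<^bsub>tensor_free A N\<^esub>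
                  frag_extend (\<lambda>(b, n). frag_of (a \<otimes>\<^bsub>A\<^esub> b, n)) z)\<rparr>)"

definition quotient_module :: "('r, 'x) ring_scheme \<Rightarrow> 'r set \<Rightarrow> ('r, 'r set) module" where
  "quotient_module R I =
     ring.extend (R Quot I) (module.fields (\<lambda>r c. (I +>\<^bsub>R\<^esub> r) \<otimes>\<^bsub>R Quot I\<^esub> c))"

definition U_mod :: "'a::field poly \<Rightarrow> 'a poly set
    \<Rightarrow> ('a Ah_elt, ('a Ah_elt \<times> 'a poly set \<Rightarrow>\<^sub>0 int) set) module" where
  "U_mod h \<mm> = induced_module (Ah h) R_poly (Ah_of_poly h) (quotient_module R_poly \<mm>)"


section \<open>The definitions give modules\<close>

lemma ring_of_type_algebra_ring: "ring (ring_of_type_algebra :: 'a::ring_1 ring)"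
proof -
  have "\<exists>y. x + y = 0" for x :: 'a
    using add.right_inverse by blast
  then show ?thesis
    unfolding ring_of_type_algebra_def using add.right_inverse
    by unfold_locales (auto simp: algebra_simps Units_def)
qed

lemma ideal_rel_ideal: "ideal (rel_ideal h) ring_of_type_algebra"
  unfolding rel_ideal_def
  by (rule ring.genideal_ideal[OF ring_of_type_algebra_ring]) (simp add: ring_of_type_algebra_def)

lemma ring_Ah: "ring (Ah h)"
  unfolding Ah_def by (rule ideal.quotient_is_ring[OF ideal_rel_ideal])

lemma Ah_of_free_hom: "Ah_of_free h \<in> ring_hom ring_of_type_algebra (Ah h)"
  using ideal.rcos_ring_hom[OF ideal_rel_ideal, of h]
  by (simp add: Ah_def Ah_of_free_def[abs_def])

lemma Ah_of_free_eq_iff: "Ah_of_free h p = Ah_of_free h q \<longleftrightarrow> p - q \<in> rel_ideal h"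
proof -
  interpret ideal "rel_ideal h" "ring_of_type_algebra :: 'a free_alg ring"
    by (rule ideal_rel_ideal)
  have "p - q = p \<ominus>\<^bsub>ring_of_type_algebra\<^esub> q"
  proof -
    have "\<ominus>\<^bsub>ring_of_type_algebra\<^esub> q = - q"
      using minus_equality[of "-q" q] by (simp add: ring_of_type_algebra_def)
    then show ?thesis by (simp add: a_minus_def) (simp add: ring_of_type_algebra_def)
  qed
  then show ?thesis
    unfolding Ah_of_free_def
    using quotient_eq_iff_same_a_r_cos[OF ideal_rel_ideal, of p q]
    by (simp add: ring_of_type_algebra_def)
qed

lemma Ah_relation:
  "Ah_y h \<otimes>\<^bsub>Ah h\<^esub> Ah_x h = Ah_x h \<otimes>\<^bsub>Ah h\<^esub> Ah_y h \<oplus>\<^bsub>Ah h\<^esub> Ah_of_poly h h"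
proof -
  have m: "Ah_of_free h (p * q) = Ah_of_free h p \<otimes>\<^bsub>Ah h\<^esub> Ah_of_free h q"
   and a: "Ah_of_free h (p + q) = Ah_of_free h p \<oplus>\<^bsub>Ah h\<^esub> Ah_of_free h q" for p q
    using ring_hom_mult[OF Ah_of_free_hom[of h], of p q] ring_hom_add[OF Ah_of_free_hom[of h], of p q]
    by (simp_all add: ring_of_type_algebra_def)
  have "freeY * freeX - (freeX * freeY + free_of_poly h) \<in> rel_ideal h"
    unfolding rel_ideal_def
    by (rule ring.genideal_self'[OF ring_of_type_algebra_ring]) (simp add: ring_of_type_algebra_def)
  then show ?thesis
    by (simp add: m[symmetric] a[symmetric] Ah_of_free_eq_iff)
qed

abbreviation (input) word_val where
  "word_val lam mu w \<equiv> prod_list (map (gen_eval lam mu) (letters w))"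

lemma word_val_add: "word_val lam mu (u + v) = word_val lam mu u * (word_val lam mu v :: 'a::field)"
  by (simp add: plus_word_def)

lemma free_eval_superset:
  assumes "finite S" "Poly_Mapping.keys p \<subseteq> S"
  shows "free_eval lam mu p = (\<Sum>w\<in>S. Poly_Mapping.lookup p w * word_val lam mu w)"
  unfolding free_eval_def
  by (rule sum.mono_neutral_left) (use assms in \<open>auto simp: in_keys_iff\<close>)

lemma free_eval_add: "free_eval lam mu (p + q) = free_eval lam mu p + free_eval lam mu q"
proof -
  let ?S = "Poly_Mapping.keys p \<union> Poly_Mapping.keys q"
  have "free_eval lam mu r = (\<Sum>w\<in>?S. Poly_Mapping.lookup r w * word_val lam mu w)"
    if "r \<in> {p, q, p + q}" for r
    by (rule free_eval_superset) (use that keys_add[of p q] in auto)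
  then show ?thesis by (simp add: lookup_add distrib_right sum.distrib)
qed

lemma free_eval_zero: "free_eval lam mu 0 = 0"
  by (simp add: free_eval_def)

lemma free_eval_sum: "free_eval lam mu (sum f A) = (\<Sum>i\<in>A. free_eval lam mu (f i))"
  by (induction A rule: infinite_finite_induct) (auto simp: free_eval_add free_eval_zero)

lemma free_eval_single: "free_eval lam mu (Poly_Mapping.single w c) = c * word_val lam mu w"
  by (simp add: free_eval_def)

lemma free_alg_expand: "p = (\<Sum>w\<in>Poly_Mapping.keys p. Poly_Mapping.single w (Poly_Mapping.lookup p w))"
  for p :: "'a::field free_alg"
  by (rule poly_mapping_eqI)
     (simp add: lookup_sum lookup_single when_def in_keys_iff)

lemma free_eval_mult: "free_eval lam mu (p * q) = free_eval lam mu p * free_eval lam mu q"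
proof -
  have "p * q = (\<Sum>u\<in>Poly_Mapping.keys p. \<Sum>v\<in>Poly_Mapping.keys q.
     Poly_Mapping.single (u + v) (Poly_Mapping.lookup p u * Poly_Mapping.lookup q v))"
    by (subst free_alg_expand[of p], subst free_alg_expand[of q])
       (simp add: sum_product mult_single)
  then show ?thesis
    by (simp add: free_eval_sum free_eval_single word_val_add)
       (simp add: free_eval_def sum_product mult_ac)
qed

lemma free_eval_one: "free_eval lam mu 1 = 1"
  unfolding single_one[symmetric] free_eval_single by (simp add: zero_word_def)

lemma free_eval_X: "free_eval lam mu freeX = lam"
  by (simp add: freeX_def free_eval_single)

lemma free_eval_Y: "free_eval lam mu freeY = mu"
  by (simp add: freeY_def free_eval_single)

lemma free_eval_poly: "free_eval lam mu (free_of_poly p) = poly p lam"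
  by (simp add: free_of_poly_def free_eval_sum free_eval_single poly_altdef)

lemma free_eval_minus: "free_eval lam mu (p - q) = free_eval lam mu p - free_eval lam mu q"
  by (metis add_diff_cancel diff_add_cancel free_eval_add)

lemma free_eval_rel:
  assumes "poly h lam = 0" "p \<in> rel_ideal h"
  shows "free_eval lam mu p = 0"
proof -
  let ?F = "ring_of_type_algebra :: 'a free_alg ring"
  let ?K = "ring_of_type_algebra :: 'a ring"
  have "ring_hom_ring ?F ?K (free_eval lam mu)"
    by (rule ring_hom_ringI[OF ring_of_type_algebra_ring ring_of_type_algebra_ring])
       (simp_all add: ring_of_type_algebra_def free_eval_add free_eval_mult free_eval_one)
  note hom = this
  have ker: "a_kernel ?F ?K (free_eval lam mu) = {p. free_eval lam mu p = 0}"
    unfolding a_kernel_def kernel_def by (simp add: ring_of_type_algebra_def)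
  have "rel_ideal h \<subseteq> {p. free_eval lam mu p = 0}"
    unfolding rel_ideal_def
    by (rule ring.genideal_minimal[OF ring_of_type_algebra_ring ring_hom_ring.kernel_is_ideal[OF hom], unfolded ker])
       (simp add: free_eval_minus free_eval_add free_eval_mult
          free_eval_X free_eval_Y free_eval_poly assms(1))
  with assms(2) show ?thesis by auto
qed

lemma one_dim_smult:
  assumes "poly h lam = 0"
  shows "Ah_of_free h p \<odot>\<^bsub>one_dim_module lam mu\<^esub> c = free_eval lam mu p * c"
proof -
  have "free_eval lam mu ` Ah_of_free h p = {free_eval lam mu p}"
  proof -
    interpret ideal "rel_ideal h" "ring_of_type_algebra :: 'a free_alg ring"
      by (rule ideal_rel_ideal)
    have "q \<in> Ah_of_free h p \<longleftrightarrow> (\<exists>r\<in>rel_ideal h. q = r + p)" for q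
      by (auto simp: Ah_of_free_def a_r_coset_def' ring_of_type_algebra_def)
    moreover have "p \<in> Ah_of_free h p"
      unfolding Ah_of_free_def by (rule a_rcos_self) (simp add: ring_of_type_algebra_def)
    ultimately show ?thesis
      using free_eval_rel[OF assms, where mu = mu] by (fastforce simp: free_eval_add)
  qed
  then show ?thesis
    by (simp add: one_dim_module_def ring.defs module.defs ring_of_type_algebra_def)
qed

lemma carrier_Ah: "carrier (Ah h) = range (Ah_of_free h)"
  by (auto simp: Ah_def FactRing_def A_RCOSETS_def' Ah_of_free_def ring_of_type_algebra_def)

lemma left_module_one_dim:
  assumes "poly h lam = 0"
  shows "left_module (Ah h) (one_dim_module lam mu)"
proof -
  let ?M = "one_dim_module lam mu"
  have sel: "carrier ?M = UNIV" "(\<oplus>\<^bsub>?M\<^esub>) = (+)" "\<zero>\<^bsub>?M\<^esub> = 0"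
    by (simp_all add: one_dim_module_def ring.defs module.defs ring_of_type_algebra_def)
  have hom: "Ah_of_free h p \<otimes>\<^bsub>Ah h\<^esub> Ah_of_free h q = Ah_of_free h (p * q)"
    "Ah_of_free h p \<oplus>\<^bsub>Ah h\<^esub> Ah_of_free h q = Ah_of_free h (p + q)"
    "\<one>\<^bsub>Ah h\<^esub> = Ah_of_free h 1" for p q
    using ring_hom_mult[OF Ah_of_free_hom[of h], of p q] ring_hom_add[OF Ah_of_free_hom[of h], of p q]
      ring_hom_one[OF Ah_of_free_hom[of h]]
    by (simp_all add: ring_of_type_algebra_def)
  have ag: "abelian_group ?M"
    by (rule abelian_groupI) (auto simp: sel add_ac intro: exI[of _ "- _"] ab_left_minus)
  show ?thesis
    by (intro left_module.intro ring_Ah ag left_module_axioms.intro)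
       (auto simp: carrier_Ah sel hom one_dim_smult[OF assms] free_eval_add free_eval_mult
          free_eval_one algebra_simps)
qed

lemma frag_induct_on:
  assumes "Poly_Mapping.keys z \<subseteq> S" "P 0" "\<And>s. s \<in> S \<Longrightarrow> P (frag_of s)"
    "\<And>u v. \<lbrakk>P u; P v\<rbrakk> \<Longrightarrow> P (u - v)"
  shows "P z"
  using assms by (rule frag_induction)

lemma left_module_induced:
  fixes A (structure) and R :: "('r, 'y) ring_scheme" and N :: "('r,'n,'z) module_scheme"
  assumes A: "ring A" and N: "left_module R N" and phi: "\<phi> \<in> carrier R \<rightarrow> carrier A"
  shows "left_module A (induced_module A R \<phi> N)"
proof -
  interpret A: ring A by (rule A)
  interpret N: left_module R N by (rule N)
  define G where "G = tensor_free A N"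
  define H where "H = tensor_null A R \<phi> N"
  define T where "T = tensor_rels A R \<phi> N"
  define act where "act a = frag_extend (\<lambda>(b, n :: 'n). frag_of (a \<otimes> b, n))" for a
  let ?M = "induced_module A R \<phi> N"
  interpret G: comm_group G unfolding G_def tensor_free_def by (rule abelian_free_Abelian_group)
  have Gs: "carrier G = {z. Poly_Mapping.keys z \<subseteq> carrier A \<times> carrier N}"
      "x \<otimes>\<^bsub>G\<^esub> y = x + y" "\<one>\<^bsub>G\<^esub> = 0" for x y
    by (auto simp: G_def tensor_free_def free_Abelian_group_def)
  have Ginv: "inv\<^bsub>G\<^esub> x = - x" if "x \<in> carrier G" for x
    using that unfolding G_def tensor_free_def by simp
  have fr: "frag_of (a, n) \<in> carrier G" if "a \<in> carrier A" "n \<in> carrier N" for a n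
    using that by (simp add: Gs)
  have dif: "u - v \<in> carrier G" if "u \<in> carrier G" "v \<in> carrier G" for u v
    using G.m_closed[OF that(1) G.inv_closed[OF that(2)]] by (simp add: Ginv that(2) Gs(2))
  have TG: "T \<subseteq> carrier G"
    unfolding T_def tensor_rels_def
    using phi by (auto intro!: dif fr N.smult_closed simp: Pi_iff)
  have Hg: "H = generate G T" by (simp add: H_def tensor_null_def G_def T_def)
  have H: "subgroup H G" unfolding Hg by (rule G.generate_is_subgroup[OF TG])
  then have HN: "H \<lhd> G" by (rule G.subgroup_imp_normal)
  have TH: "T \<subseteq> H" unfolding Hg by (auto intro: generate.incl)
  have HG: "H \<subseteq> carrier G" using H by (rule subgroup.subset)
  have H0: "0 \<in> H" using subgroup.one_closed[OF H] by (simp add: Gs)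
  have Hadd: "u + v \<in> H" if "u \<in> H" "v \<in> H" for u v
    using subgroup.m_closed[OF H that] by (simp add: Gs)
  have Hneg: "- u \<in> H" if "u \<in> H" for u
    using subgroup.m_inv_closed[OF H that] Ginv HG that by auto
  have Hdif: "u - v \<in> H" if "u \<in> H" "v \<in> H" for u v
    using Hadd[OF that(1) Hneg[OF that(2)]] by simp
  have cos: "H #>\<^bsub>G\<^esub> u = {x + u | x. x \<in> H}" for u
    by (auto simp: r_coset_def Gs)
  have coseq: "H #>\<^bsub>G\<^esub> u = H #>\<^bsub>G\<^esub> v \<longleftrightarrow> u - v \<in> H" for u v
  proof
    assume "H #>\<^bsub>G\<^esub> u = H #>\<^bsub>G\<^esub> v"
    moreover have "u \<in> H #>\<^bsub>G\<^esub> u" using H0 by (force simp: cos)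
    ultimately show "u - v \<in> H" by (auto simp: cos)
  next
    assume *: "u - v \<in> H"
    have "x + u \<in> H #>\<^bsub>G\<^esub> v" if "x \<in> H" for x
      using Hadd[OF that *] by (force simp: cos algebra_simps)
    moreover have "x + v \<in> H #>\<^bsub>G\<^esub> u" if "x \<in> H" for x
      using Hdif[OF that *] by (force simp: cos algebra_simps)
    ultimately show "H #>\<^bsub>G\<^esub> u = H #>\<^bsub>G\<^esub> v" by (auto simp: cos[of u] cos[of v])
  qed
  have act_of: "act a (frag_of (b, n)) = frag_of (a \<otimes> b, n)" for a b n
    by (simp add: act_def)
  have act_diff: "act a (u - v) = act a u - act a v" for a u v
    by (simp add: act_def frag_extend_diff)
  have act_add: "act a (u + v) = act a u + act a v" for a u v
    by (simp add: act_def frag_extend_add)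
  have act_0: "act a 0 = 0" for a by (simp add: act_def)
  have act_G: "act a z \<in> carrier G" if a: "a \<in> carrier A" and z: "z \<in> carrier G" for a z
  proof -
    from z have "Poly_Mapping.keys z \<subseteq> carrier A \<times> carrier N" by (simp add: Gs)
    then show ?thesis
      by (rule frag_induct_on[where P = "\<lambda>z. act a z \<in> carrier G"])
         (use a G.one_closed in \<open>auto simp: act_of act_diff act_0 Gs(3) intro!: fr dif\<close>)
  qed
  have act_T: "act a t \<in> T" if a: "a \<in> carrier A" and t: "t \<in> T" for a t
  proof -
    from t consider
      (1) b c n where "t = frag_of (b \<oplus> c, n) - frag_of (b, n) - frag_of (c, n)"
        "b \<in> carrier A" "c \<in> carrier A" "n \<in> carrier N"
    | (2) b n n' where "t = frag_of (b, n \<oplus>\<^bsub>N\<^esub> n') - frag_of (b, n) - frag_of (b, n')"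
        "b \<in> carrier A" "n \<in> carrier N" "n' \<in> carrier N"
    | (3) b r n where "t = frag_of (b \<otimes> \<phi> r, n) - frag_of (b, r \<odot>\<^bsub>N\<^esub> n)"
        "b \<in> carrier A" "r \<in> carrier R" "n \<in> carrier N"
      unfolding T_def tensor_rels_def by blast
    then show ?thesis
    proof cases
      case 1
      then have "act a t = frag_of (a \<otimes> b \<oplus> a \<otimes> c, n) - frag_of (a \<otimes> b, n) - frag_of (a \<otimes> c, n)"
        using a by (simp add: act_diff act_of A.r_distr)
      then show ?thesis unfolding T_def tensor_rels_def using a 1 by blast
    next
      case 2
      then have "act a t = frag_of (a \<otimes> b, n \<oplus>\<^bsub>N\<^esub> n') - frag_of (a \<otimes> b, n) - frag_of (a \<otimes> b, n')"
        by (simp add: act_diff act_of)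
      then show ?thesis unfolding T_def tensor_rels_def using a 2 by blast
    next
      case 3
      then have "act a t = frag_of (a \<otimes> b \<otimes> \<phi> r, n) - frag_of (a \<otimes> b, r \<odot>\<^bsub>N\<^esub> n)"
        using a phi by (simp add: act_diff act_of A.m_assoc Pi_iff)
      then show ?thesis unfolding T_def tensor_rels_def using a 3 by blast
    qed
  qed
  have act_H: "act a z \<in> H" if a: "a \<in> carrier A" and z: "z \<in> H" for a z
    using z unfolding Hg
  proof (induction rule: generate.induct)
    case one show ?case using H0 by (simp add: Gs act_0 Hg)
  next
    case (incl t) then show ?case using act_T[OF a] TH Hg by blast
  next
    case (inv t)
    then have "inv\<^bsub>G\<^esub> t = 0 - t" using Ginv TG by auto
    then have "act a (inv\<^bsub>G\<^esub> t) = - act a t" by (simp only: act_diff act_0) simp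
    then show ?case using Hneg[of "act a t"] act_T[OF a inv] TH by (auto simp: Hg)
  next
    case (eng u v) then show ?case using Hadd by (simp add: Gs act_add Hg)
  qed
  have sm: "a \<odot>\<^bsub>?M\<^esub> (H #>\<^bsub>G\<^esub> z) = H #>\<^bsub>G\<^esub> act a z" if a: "a \<in> carrier A" for a z
  proof -
    have "a \<odot>\<^bsub>?M\<^esub> (H #>\<^bsub>G\<^esub> z) = (\<Union>w\<in>H #>\<^bsub>G\<^esub> z. H #>\<^bsub>G\<^esub> act a w)"
      by (simp add: induced_module_def Let_def H_def[symmetric] G_def[symmetric] act_def)
    also have "H #>\<^bsub>G\<^esub> act a w = H #>\<^bsub>G\<^esub> act a z" if "w \<in> H #>\<^bsub>G\<^esub> z" for w
      using that act_H[OF a] unfolding coseq act_diff[symmetric] by (auto simp: cos)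
    then have "(\<Union>w\<in>H #>\<^bsub>G\<^esub> z. H #>\<^bsub>G\<^esub> act a w) = (\<Union>w\<in>H #>\<^bsub>G\<^esub> z. H #>\<^bsub>G\<^esub> act a z)" by auto
    also have "\<dots> = H #>\<^bsub>G\<^esub> act a z" using H0 by (auto simp: cos[of z])
    finally show ?thesis .
  qed
  have add: "(H #>\<^bsub>G\<^esub> u) \<oplus>\<^bsub>?M\<^esub> (H #>\<^bsub>G\<^esub> v) = H #>\<^bsub>G\<^esub> (u + v)"
    if "u \<in> carrier G" "v \<in> carrier G" for u v
    using normal.rcos_sum[OF HN that]
    by (simp add: induced_module_def Let_def H_def[symmetric] G_def[symmetric] FactGroup_def Gs(2))
  have zero: "\<zero>\<^bsub>?M\<^esub> = H #>\<^bsub>G\<^esub> 0"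
    using cos[of 0]
    by (simp add: induced_module_def Let_def H_def[symmetric] G_def[symmetric] FactGroup_def)
  have car: "carrier ?M = (\<lambda>z. H #>\<^bsub>G\<^esub> z) ` carrier G"
    by (auto simp: induced_module_def Let_def H_def[symmetric] G_def[symmetric] FactGroup_def RCOSETS_def)
  have z0: "0 \<in> carrier G" using G.one_closed by (simp add: Gs(3))
  have padd: "u + v \<in> carrier G" if "u \<in> carrier G" "v \<in> carrier G" for u v
    using G.m_closed[OF that] by (simp add: Gs(2))
  have ag: "abelian_group ?M"
  proof (rule abelian_groupI)
    fix x assume "x \<in> carrier ?M"
    then obtain u where u: "x = H #>\<^bsub>G\<^esub> u" "u \<in> carrier G" by (auto simp: car)
    have "(H #>\<^bsub>G\<^esub> (0 - u)) \<oplus>\<^bsub>?M\<^esub> x = \<zero>\<^bsub>?M\<^esub>"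
      unfolding u(1) by (subst add[OF dif[OF z0 u(2)] u(2)]) (simp add: zero)
    then show "\<exists>y\<in>carrier ?M. y \<oplus>\<^bsub>?M\<^esub> x = \<zero>\<^bsub>?M\<^esub>"
      using dif[OF z0 u(2)] by (auto simp: car)
  qed (auto simp: car add zero padd z0 add_ac)
  have ld: "act (a \<oplus> b) z - (act a z + act b z) \<in> H"
    if a: "a \<in> carrier A" and b: "b \<in> carrier A" and z: "z \<in> carrier G" for a b z
  proof -
    from z have "Poly_Mapping.keys z \<subseteq> carrier A \<times> carrier N" by (simp add: Gs)
    then show ?thesis
    proof (rule frag_induct_on[where P = "\<lambda>z. act (a \<oplus> b) z - (act a z + act b z) \<in> H"], goal_cases)
      case 1 show ?case by (simp add: act_0 H0)
    next
      case (2 s)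
      then obtain c n where s: "s = (c, n)" "c \<in> carrier A" "n \<in> carrier N" by auto
      have "act (a \<oplus> b) (frag_of s) - (act a (frag_of s) + act b (frag_of s))
          = frag_of (a \<otimes> c \<oplus> b \<otimes> c, n) - frag_of (a \<otimes> c, n) - frag_of (b \<otimes> c, n)"
        using a b s by (simp add: act_of A.l_distr)
      also have "\<dots> \<in> T" unfolding T_def tensor_rels_def using a b s A.m_closed by blast
      finally show ?case using TH by blast
    next
      case (3 u v)
      from Hdif[OF 3] show ?case by (simp add: act_diff algebra_simps)
    qed
  qed
  have assoc: "act (a \<otimes> b) z = act a (act b z)"
    if a: "a \<in> carrier A" and b: "b \<in> carrier A" and z: "z \<in> carrier G" for a b z
  proof -
    from z have "Poly_Mapping.keys z \<subseteq> carrier A \<times> carrier N" by (simp add: Gs)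
    then show ?thesis
      by (rule frag_induct_on[where P = "\<lambda>z. act (a \<otimes> b) z = act a (act b z)"])
         (use a b in \<open>auto simp: act_of act_diff act_0 A.m_assoc\<close>)
  qed
  have uni: "act \<one> z = z" if z: "z \<in> carrier G" for z
  proof -
    from z have "Poly_Mapping.keys z \<subseteq> carrier A \<times> carrier N" by (simp add: Gs)
    then show ?thesis
      by (rule frag_induct_on[where P = "\<lambda>z. act \<one> z = z"])
         (auto simp: act_of act_diff act_0)
  qed
  show ?thesis
  proof (intro left_module.intro A ag left_module_axioms.intro)
    fix a b v
    assume a: "a \<in> carrier A" and b: "b \<in> carrier A" and "v \<in> carrier ?M"
    then obtain z where z: "v = H #>\<^bsub>G\<^esub> z" "z \<in> carrier G" by (auto simp: car)
    have "H #>\<^bsub>G\<^esub> act (a \<oplus> b) z = H #>\<^bsub>G\<^esub> (act a z + act b z)"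
      unfolding coseq by (rule ld[OF a b z(2)])
    then show "(a \<oplus> b) \<odot>\<^bsub>?M\<^esub> v = a \<odot>\<^bsub>?M\<^esub> v \<oplus>\<^bsub>?M\<^esub> b \<odot>\<^bsub>?M\<^esub> v"
      using a b z by (simp add: sm add act_G)
  qed (auto simp: car sm add act_G padd act_add assoc uni)
qed

lemma left_module_quotient:
  assumes "ideal I R"
  shows "left_module R (quotient_module R I)"
proof -
  interpret I: ideal I R by (rule assms)
  interpret Q: ring "R Quot I" by (rule I.quotient_is_ring)
  let ?M = "quotient_module R I"
  have sel: "carrier ?M = carrier (R Quot I)" "(\<oplus>\<^bsub>?M\<^esub>) = (\<oplus>\<^bsub>R Quot I\<^esub>)"
      "\<zero>\<^bsub>?M\<^esub> = \<zero>\<^bsub>R Quot I\<^esub>" "r \<odot>\<^bsub>?M\<^esub> c = (I +>\<^bsub>R\<^esub> r) \<otimes>\<^bsub>R Quot I\<^esub> c" for r c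
    by (simp_all add: quotient_module_def ring.defs module.defs)
  note hom = I.rcos_ring_hom
  have "abelian_group ?M"
    by (rule abelian_groupI) (auto simp: sel Q.a_ac intro: Q.l_neg exI)
  then show ?thesis
    by (intro left_module.intro I.ring_axioms left_module_axioms.intro)
       (use ring_hom_closed[OF hom] ring_hom_mult[OF hom] ring_hom_add[OF hom] ring_hom_one[OF hom]
         in \<open>auto simp: sel Q.l_distr Q.r_distr Q.m_assoc\<close>)
qed

lemma left_module_U_mod:
  assumes "ideal \<mm> R_poly"
  shows "left_module (Ah h) (U_mod h \<mm>)"
  unfolding U_mod_def
  by (rule left_module_induced[OF ring_Ah left_module_quotient[OF assms]]) (auto simp: carrier_Ah)


end

theory Submission
  imports Defs
begin

text \<open>Let \<open>u\<close> be a nonzero vector of \<open>V\<close> with \<open>x u = lam u\<close>; it exists because some power of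
  \<open>f = x - lam\<close> kills a nonzero vector, and it generates \<open>V\<close> by irreducibility. Modulo any left ideal
  \<open>J\<close> that contains \<open>x - lam\<close>, every element of \<open>A\<^sub>h\<close> is congruent to a polynomial in \<open>y\<close>, and
  multiplication by \<open>x - lam\<close> acts on these polynomials as \<open>- h(lam) d/dy\<close> up to terms of lower degree.

  If \<open>h(lam) \<noteq> 0\<close>, then in characteristic 0 this lowers degrees by exactly one, so a proper \<open>J\<close> contains
  no nonzero polynomial in \<open>y\<close> and hence equals \<open>A\<^sub>h f\<close>. In particular \<open>A\<^sub>h f\<close> is the annihilator
  of \<open>u\<close>, and it is also the annihilator of the generator of \<open>U(\<mm>)\<close>.

  If \<open>h(lam) = 0\<close>, the \<open>lam\<close>-eigenspace of \<open>x\<close> is stable under \<open>y\<close>. Either \<open>y u = 0\<close>, or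
  \<open>u = g(y) y u\<close> for some polynomial \<open>g\<close>, so that \<open>1 - g(y) y\<close> kills \<open>u\<close>; factoring this
  polynomial gives a common eigenvector of \<open>x\<close> and \<open>y\<close>.\<close>

section \<open>Polynomials in the generators\<close>

abbreviation scal :: "'a::field \<Rightarrow> 'a free_alg" where
  "scal c \<equiv> Poly_Mapping.single 0 c"

lemma scal_commute: "p * scal c = scal c * p"
proof -
  have "Poly_Mapping.single w d * scal c = scal c * Poly_Mapping.single w d" for w and d :: 'a
    by (simp add: mult_single mult.commute)
  then show ?thesis
    by (subst (1 2) free_alg_expand[of p]) (simp add: sum_distrib_left sum_distrib_right)
qed

lemma scal_left_commute: "p * (scal c * q) = scal c * (p * q)"
  by (metis mult.assoc scal_commute)

lemma scal_mult: "scal c * scal d = scal (c * d)" "scal c * (scal d * q) = scal (c * d) * q"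
  by (simp_all add: mult_single mult.assoc[symmetric])

lemma scal_inverse: "c \<noteq> 0 \<Longrightarrow> scal (inverse c) * scal c = 1"
  by (simp add: mult_single)

definition poly_at :: "'a::field free_alg \<Rightarrow> 'a poly \<Rightarrow> 'a free_alg" where
  "poly_at z p = fold_coeffs (\<lambda>a s. scal a + z * s) p 0"

lemma poly_at_0 [simp]: "poly_at z 0 = 0"
  by (simp add: poly_at_def)

lemma poly_at_pCons [simp]: "poly_at z (pCons a p) = scal a + z * poly_at z p"
  by (cases "a = 0 \<and> p = 0") (auto simp: poly_at_def)

lemma poly_at_1 [simp]: "poly_at z 1 = 1"
  by (simp add: one_pCons)

lemma poly_at_add: "poly_at z (p + q) = poly_at z p + poly_at z q"
  by (induction p q rule: poly_induct2) (simp_all add: single_add algebra_simps)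

lemma poly_at_smult: "poly_at z (smult c p) = scal c * poly_at z p"
  by (induction p) (simp_all add: mult_single distrib_left scal_left_commute)

lemma poly_at_diff: "poly_at z (p - q) = poly_at z p - poly_at z q"
  by (metis add_diff_cancel diff_add_cancel poly_at_add)

lemma poly_at_mult: "poly_at z (p * q) = poly_at z p * poly_at z q"
  by (induction p) (simp_all add: poly_at_add poly_at_smult algebra_simps)

text \<open>Oriented instances of commutation with scalars: as a simplification rule, the general law may
  stop before the scalar is in front.\<close>

lemmas scal_front =
  scal_mult
  scal_commute[of freeX] scal_left_commute[of freeX]
  scal_commute[of freeY] scal_left_commute[of freeY]
  scal_commute[of "poly_at z g"] scal_left_commute[of "poly_at z g"] for z g

lemma X_times_word: "freeX * Poly_Mapping.single (Word ws) c = Poly_Mapping.single (Word (GenX # ws)) c"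
  by (simp add: freeX_def mult_single plus_word_def)

lemma Y_times_word: "freeY * Poly_Mapping.single (Word ws) c = Poly_Mapping.single (Word (GenY # ws)) c"
  by (simp add: freeY_def mult_single plus_word_def)

lemma free_alg_induct [case_names scal X Y add]:
  assumes scal: "\<And>c. P (scal c)"
    and X: "\<And>p. P p \<Longrightarrow> P (freeX * p)"
    and Y: "\<And>p. P p \<Longrightarrow> P (freeY * p)"
    and add: "\<And>p q. P p \<Longrightarrow> P q \<Longrightarrow> P (p + q)"
  shows "P (p :: 'a::field free_alg)"
proof -
  have word: "P (Poly_Mapping.single (Word ws) c)" for ws c
  proof (induction ws)
    case Nil show ?case using scal[of c] by (simp add: zero_word_def)
  next
    case (Cons x ws)
    then show ?case
      using X[of "Poly_Mapping.single (Word ws) c"] Y[of "Poly_Mapping.single (Word ws) c"]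
      by (cases x) (simp_all add: X_times_word Y_times_word)
  qed
  have "P (\<Sum>w\<in>S. Poly_Mapping.single w (c w))" for S and c :: "word \<Rightarrow> 'a"
    using scal[of 0] word[of "letters _"]
    by (induction S rule: infinite_finite_induct) (auto intro: add)
  then show ?thesis by (subst free_alg_expand[of p])
qed

lemma free_of_poly_eq_poly_at: "free_of_poly p = poly_at freeX p"
proof -
  have bound: "free_of_poly p = (\<Sum>i\<le>n. Poly_Mapping.single (Word (replicate i GenX)) (Polynomial.coeff p i))"
    if "Polynomial.degree p \<le> n" for p :: "'a poly" and n
    unfolding free_of_poly_def
    by (rule sum.mono_neutral_left) (use that in \<open>auto simp: coeff_eq_0\<close>)
  show ?thesis
  proof (induction p)
    case 0 show ?case by (simp add: free_of_poly_def)
  next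
    case (pCons a p)
    have "free_of_poly (pCons a p) = scal a + freeX * free_of_poly p"
      by (subst bound[of _ "Suc (Polynomial.degree p)"])
        (simp_all add: sum.atMost_Suc_shift zero_word_def degree_pCons_le free_of_poly_def
          sum_distrib_left X_times_word del: sum.atMost_Suc)
    with pCons show ?case by simp
  qed
qed

lemma Ah_hom:
  "Ah_of_free h p \<otimes>\<^bsub>Ah h\<^esub> Ah_of_free h q = Ah_of_free h (p * q)"
  "Ah_of_free h p \<oplus>\<^bsub>Ah h\<^esub> Ah_of_free h q = Ah_of_free h (p + q)"
  "\<one>\<^bsub>Ah h\<^esub> = Ah_of_free h 1"
  "\<zero>\<^bsub>Ah h\<^esub> = Ah_of_free h 0"
  using ring_hom_mult[OF Ah_of_free_hom[of h], of p q] ring_hom_add[OF Ah_of_free_hom[of h], of p q]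
    ring_hom_one[OF Ah_of_free_hom[of h]]
    ring_hom_zero[OF Ah_of_free_hom[of h] ring_of_type_algebra_ring ring_Ah]
  by (simp_all add: ring_of_type_algebra_def)

lemma
  shows rel_ideal_zero: "0 \<in> rel_ideal h"
    and rel_ideal_add: "p \<in> rel_ideal h \<Longrightarrow> q \<in> rel_ideal h \<Longrightarrow> p + q \<in> rel_ideal h"
    and rel_ideal_lmult: "p \<in> rel_ideal h \<Longrightarrow> q * p \<in> rel_ideal h"
    and rel_ideal_rmult: "p \<in> rel_ideal h \<Longrightarrow> p * q \<in> rel_ideal h"
  using additive_subgroup.zero_closed[OF ideal.axioms(1)[OF ideal_rel_ideal[of h]]]
    additive_subgroup.a_closed[OF ideal.axioms(1)[OF ideal_rel_ideal[of h]], of p q]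
    ideal.I_l_closed[OF ideal_rel_ideal[of h], of p q]
    ideal.I_r_closed[OF ideal_rel_ideal[of h], of p q]
  by (simp_all add: ring_of_type_algebra_def)

lemma rel_ideal_uminus: "p \<in> rel_ideal h \<Longrightarrow> - p \<in> rel_ideal h"
  using rel_ideal_lmult[of p h "-1"] by simp

lemma rel_ideal_rel: "freeY * freeX - freeX * freeY - poly_at freeX h \<in> rel_ideal h"
  unfolding rel_ideal_def free_of_poly_eq_poly_at[symmetric] diff_diff_add
  by (rule ring.genideal_self'[OF ring_of_type_algebra_ring]) (simp add: ring_of_type_algebra_def)

lemma rel_ideal_pderiv: "freeY * poly_at freeX r - poly_at freeX r * freeY - poly_at freeX (h * pderiv r) \<in> rel_ideal h"
proof (induction r)
  case 0 show ?case by (simp add: rel_ideal_zero)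
next
  case (pCons a r)
  let ?X = freeX and ?Y = freeY and ?r = "poly_at freeX r" and ?h = "poly_at freeX h"
  have "?Y * poly_at ?X (pCons a r) - poly_at ?X (pCons a r) * ?Y - poly_at ?X (h * pderiv (pCons a r))
      = (?Y * ?X - ?X * ?Y - ?h) * ?r + ?X * (?Y * ?r - ?r * ?Y - poly_at ?X (h * pderiv r))"
    by (simp add: pderiv_pCons poly_at_add poly_at_mult algebra_simps scal_front)
  then show ?case
    using rel_ideal_add[OF rel_ideal_rmult[OF rel_ideal_rel] rel_ideal_lmult[OF pCons(2)]] by simp
qed

section \<open>Left ideals containing \<open>x - lam\<close>\<close>

locale Ah_left_ideal =
  fixes h :: "'a::field poly" and lam :: 'a and J :: "'a free_alg set"
  assumes rel: "rel_ideal h \<subseteq> J"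
    and add: "p \<in> J \<Longrightarrow> q \<in> J \<Longrightarrow> p + q \<in> J"
    and lmult: "p \<in> J \<Longrightarrow> q * p \<in> J"
    and root: "freeX - scal lam \<in> J"
begin

lemma zero: "0 \<in> J"
  using rel rel_ideal_zero by blast

lemma uminus: "p \<in> J \<Longrightarrow> - p \<in> J"
  using lmult[of p "-1"] by simp

lemma diff: "p \<in> J \<Longrightarrow> q \<in> J \<Longrightarrow> p - q \<in> J"
  using add[OF _ uminus, of p q] by simp

lemma scal_in: "scal c \<in> J \<Longrightarrow> 1 \<notin> J \<Longrightarrow> c = 0"
  using lmult[of "scal c" "scal (inverse c)"] scal_inverse by metis

lemma cong_value: "poly_at freeX r - scal (poly r lam) \<in> J"
proof (induction r)
  case 0 then show ?case by (simp add: zero)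
next
  case (pCons a r)
  have "poly_at freeX (pCons a r) - scal (poly (pCons a r) lam)
      = freeX * (poly_at freeX r - scal (poly r lam)) + scal (poly r lam) * (freeX - scal lam)"
    by (simp add: single_add algebra_simps scal_front)
  with lmult[OF pCons(2)] lmult[OF root] show ?case by (simp add: add)
qed

lemma cong_pderiv_step:
  "poly_at freeX r * (freeY * q) - (freeY * (poly_at freeX r * q) - poly_at freeX (h * pderiv r) * q) \<in> J"
proof -
  have "- ((freeY * poly_at freeX r - poly_at freeX r * freeY - poly_at freeX (h * pderiv r)) * q) \<in> J"
    using rel_ideal_uminus[OF rel_ideal_rmult[OF rel_ideal_pderiv]] rel by blast
  then show ?thesis by (simp add: algebra_simps)
qed

lemma cong_poly_at_mult:
  assumes "Polynomial.degree g \<le> n"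
  shows "\<exists>k. poly_at freeX r * poly_at freeY g - poly_at freeY k \<in> J \<and> Polynomial.degree k \<le> n \<and>
    Polynomial.coeff k n = poly r lam * Polynomial.coeff g n"
  using assms
proof (induction n arbitrary: g r)
  case 0
  then obtain a where g: "g = [:a:]" by (auto elim: degree_eq_zeroE)
  have "scal a * (poly_at freeX r - scal (poly r lam)) \<in> J" by (rule lmult[OF cong_value])
  then show ?case
    by (intro exI[of _ "[:poly r lam * a:]"])
      (simp add: g algebra_simps scal_front)
next
  case (Suc n)
  obtain a g' where g: "g = pCons a g'" by (cases g)
  have d: "Polynomial.degree g' \<le> n" using Suc.prems by (simp add: g split: if_splits)
  obtain k1 where k1: "poly_at freeX r * poly_at freeY g' - poly_at freeY k1 \<in> J" "Polynomial.degree k1 \<le> n"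
    "Polynomial.coeff k1 n = poly r lam * Polynomial.coeff g' n"
    using Suc.IH[OF d] by blast
  obtain k2 where k2: "poly_at freeX (h * pderiv r) * poly_at freeY g' - poly_at freeY k2 \<in> J" "Polynomial.degree k2 \<le> n"
    using Suc.IH[OF d] by blast
  let ?k = "pCons (poly r lam * a) k1 - k2"
  have "poly_at freeX r * poly_at freeY g - poly_at freeY ?k =
      scal a * (poly_at freeX r - scal (poly r lam))
    + (poly_at freeX r * (freeY * poly_at freeY g') - (freeY * (poly_at freeX r * poly_at freeY g') - poly_at freeX (h * pderiv r) * poly_at freeY g'))
    + freeY * (poly_at freeX r * poly_at freeY g' - poly_at freeY k1)
    - (poly_at freeX (h * pderiv r) * poly_at freeY g' - poly_at freeY k2)"
    by (simp add: g poly_at_diff algebra_simps scal_front)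
  also have "\<dots> \<in> J"
    by (intro add diff lmult cong_value cong_pderiv_step k1 k2)
  finally have "poly_at freeX r * poly_at freeY g - poly_at freeY ?k \<in> J" .
  moreover have "Polynomial.degree ?k \<le> Suc n"
    using k1(2) k2(2) by (intro degree_diff_le) (auto intro: order.trans[OF degree_pCons_le])
  moreover have "Polynomial.coeff ?k (Suc n) = poly r lam * Polynomial.coeff g (Suc n)"
    using k1(3) k2(2) by (simp add: g coeff_eq_0)
  ultimately show ?case by blast
qed

lemma cong_poly_at_Y: "\<exists>g. p - poly_at freeY g \<in> J"
proof (induction p rule: free_alg_induct)
  case (scal c)
  show ?case by (rule exI[of _ "[:c:]"]) (simp add: zero)
next
  case (X p)
  then obtain g where g: "p - poly_at freeY g \<in> J" by blast
  obtain k where k: "poly_at freeX [:0,1:] * poly_at freeY g - poly_at freeY k \<in> J"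
    using cong_poly_at_mult[OF order.refl] by blast
  from add[OF lmult[OF g, of freeX] k] show ?case
    by (intro exI[of _ k]) (simp add: algebra_simps)
next
  case (Y p)
  then obtain g where "p - poly_at freeY g \<in> J" by blast
  from lmult[OF this, of freeY] show ?case
    by (intro exI[of _ "pCons 0 g"]) (simp add: algebra_simps)
next
  case (add p q)
  then obtain g g' where "p - poly_at freeY g \<in> J" "q - poly_at freeY g' \<in> J" by blast
  from Ah_left_ideal.add[OF Ah_left_ideal_axioms this] show ?case
    by (intro exI[of _ "g + g'"]) (simp add: poly_at_add algebra_simps)
qed

lemma cong_free_eval:
  assumes Y: "freeY - scal mu \<in> J"
  shows "p - scal (free_eval lam mu p) \<in> J"
proof (induction p rule: free_alg_induct)
  case (scal c)
  show ?case by (simp add: free_eval_single zero_word_def zero)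
next
  case (X p)
  from add[OF lmult[OF X, of freeX] lmult[OF root, of "scal (free_eval lam mu p)"]] show ?case
    by (simp add: free_eval_mult free_eval_X algebra_simps scal_front)
next
  case (Y p)
  from add[OF lmult[OF Y, of freeY] lmult[OF assms, of "scal (free_eval lam mu p)"]] show ?case
    by (simp add: free_eval_mult free_eval_Y algebra_simps scal_front)
next
  case (add p q)
  from Ah_left_ideal.add[OF Ah_left_ideal_axioms add] show ?case
    by (simp add: free_eval_add single_add algebra_simps)
qed

lemma root_poly_at_Y:
  assumes "poly h lam = 0"
  shows "(freeX - scal lam) * poly_at freeY g \<in> J"
proof (induction g)
  case 0 show ?case by (simp add: zero)
next
  case (pCons a g)
  obtain q where q: "h = q * [:- lam, 1:]"
    using assms by (metis dvd_def mult.commute poly_eq_0_iff_dvd)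
  have h: "poly_at freeX h * poly_at freeY g \<in> J"
    using lmult[OF pCons(2), of "poly_at freeX q"]
    unfolding q poly_at_mult by (simp add: algebra_simps scal_front single_uminus)
  have step: "freeX * (freeY * poly_at freeY g) - (freeY * (freeX * poly_at freeY g) - poly_at freeX h * poly_at freeY g) \<in> J"
    using cong_pderiv_step[of "[:0,1:]" "poly_at freeY g"] by (simp add: pderiv_pCons)
  from diff[OF add[OF add[OF lmult[OF root, of "scal a"] step] lmult[OF pCons(2), of freeY]] h]
  show ?case by (simp add: algebra_simps scal_front)
qed

text \<open>\<open>pCons 0 k\<close> in place of \<open>k\<close> covers \<open>n = 0\<close> without truncated subtraction.\<close>

lemma cong_root_mult:
  assumes "Polynomial.degree g \<le> n"
  shows "\<exists>k. (freeX - scal lam) * poly_at freeY g - poly_at freeY k \<in> J \<and>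
    Polynomial.degree (pCons 0 k) \<le> n \<and> Polynomial.coeff (pCons 0 k) n = - of_nat n * poly h lam * Polynomial.coeff g n"
  using assms
proof (induction n arbitrary: g)
  case 0
  then obtain a where g: "g = [:a:]" by (auto elim: degree_eq_zeroE)
  show ?case using lmult[OF root, of "scal a"]
    by (intro exI[of _ 0]) (simp add: g scal_commute)
next
  case (Suc n)
  obtain a g' where g: "g = pCons a g'" by (cases g)
  have d: "Polynomial.degree g' \<le> n" using Suc.prems by (simp add: g split: if_splits)
  obtain k1 where k1: "(freeX - scal lam) * poly_at freeY g' - poly_at freeY k1 \<in> J" "Polynomial.degree (pCons 0 k1) \<le> n"
    "Polynomial.coeff (pCons 0 k1) n = - of_nat n * poly h lam * Polynomial.coeff g' n"
    using Suc.IH[OF d] by blast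
  obtain k2 where k2: "poly_at freeX h * poly_at freeY g' - poly_at freeY k2 \<in> J" "Polynomial.degree k2 \<le> n"
    "Polynomial.coeff k2 n = poly h lam * Polynomial.coeff g' n"
    using cong_poly_at_mult[OF d] by blast
  let ?k = "pCons 0 k1 - k2"
  have step: "freeX * (freeY * poly_at freeY g') - (freeY * (freeX * poly_at freeY g') - poly_at freeX h * poly_at freeY g') \<in> J"
    using cong_pderiv_step[of "[:0,1:]" "poly_at freeY g'"] by (simp add: pderiv_pCons)
  have "scal a * (freeX - scal lam)
    + (freeX * (freeY * poly_at freeY g') - (freeY * (freeX * poly_at freeY g') - poly_at freeX h * poly_at freeY g'))
    + freeY * ((freeX - scal lam) * poly_at freeY g' - poly_at freeY k1)
    - (poly_at freeX h * poly_at freeY g' - poly_at freeY k2) \<in> J"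
    by (rule diff[OF add[OF add[OF lmult[OF root] step] lmult[OF k1(1)]] k2(1)])
  also have "scal a * (freeX - scal lam)
    + (freeX * (freeY * poly_at freeY g') - (freeY * (freeX * poly_at freeY g') - poly_at freeX h * poly_at freeY g'))
    + freeY * ((freeX - scal lam) * poly_at freeY g' - poly_at freeY k1)
    - (poly_at freeX h * poly_at freeY g' - poly_at freeY k2) = (freeX - scal lam) * poly_at freeY g - poly_at freeY ?k"
    by (simp add: g poly_at_diff algebra_simps scal_front)
  finally have "(freeX - scal lam) * poly_at freeY g - poly_at freeY ?k \<in> J" .
  moreover have "Polynomial.degree (pCons 0 ?k) \<le> Suc n"
    by (intro order.trans[OF degree_pCons_le] Suc_le_mono[THEN iffD2] degree_diff_le k1 k2)
  moreover have "Polynomial.coeff (pCons 0 ?k) (Suc n) = - of_nat (Suc n) * poly h lam * Polynomial.coeff g (Suc n)"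
    using k1(3) k2(3) by (simp add: g algebra_simps)
  ultimately show ?case by blast
qed

end

lemma (in Ah_left_ideal) poly_at_Y_in_imp_zero:
  assumes "poly h lam \<noteq> 0" "1 \<notin> J" "CHAR('a) = 0"
  shows "poly_at freeY g \<in> J \<Longrightarrow> g = 0"
proof (induction "Polynomial.degree g" arbitrary: g)
  case 0
  then obtain a where g: "g = [:a:]" by (auto elim: degree_eq_zeroE)
  with 0 assms scal_in show ?case by simp
next
  case (Suc n)
  obtain k where k: "(freeX - scal lam) * poly_at freeY g - poly_at freeY k \<in> J" "Polynomial.degree (pCons 0 k) \<le> Suc n"
    "Polynomial.coeff k n = - of_nat (Suc n) * poly h lam * Polynomial.coeff g (Suc n)"
    using cong_root_mult[of g "Suc n"] Suc(2) by (metis coeff_pCons_Suc order.refl)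
  have nz: "Polynomial.coeff k n \<noteq> 0"
    using k(3) assms(1,3) Suc(2) of_nat_eq_0_iff_char_dvd[where 'a='a, of "Suc n"]
    by (metis Suc_neq_Zero degree_0 dvd_0_left leading_coeff_0_iff mult_eq_0_iff neg_equal_0_iff_equal)
  then have "k \<noteq> 0" by auto
  then have "Polynomial.degree k = n" using k(2) le_degree[OF nz] by simp
  moreover have "poly_at freeY k \<in> J"
    using diff[OF lmult[OF Suc(3), of "freeX - scal lam"] k(1)] by simp
  ultimately have "k = 0" using Suc(1) by blast
  with \<open>k \<noteq> 0\<close> show ?case by simp
qed

lemma (in Ah_left_ideal) mem_iff_principal:
  assumes "poly h lam \<noteq> 0" "1 \<notin> J" "CHAR('a) = 0"
  shows "p \<in> J \<longleftrightarrow> (\<exists>b. p - b * (freeX - scal lam) \<in> rel_ideal h)"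
proof
  assume p: "p \<in> J"
  let ?P = "{p. \<exists>b. p - b * (freeX - scal lam) \<in> rel_ideal h}"
  have "Ah_left_ideal h lam ?P"
  proof
    show "rel_ideal h \<subseteq> ?P" by (auto intro: exI[of _ 0])
    show "freeX - scal lam \<in> ?P" by (intro CollectI exI[of _ 1]) (simp add: rel_ideal_zero)
  next
    fix p q assume "p \<in> ?P" "q \<in> ?P"
    then obtain b c where "p - b * (freeX - scal lam) \<in> rel_ideal h" "q - c * (freeX - scal lam) \<in> rel_ideal h"
      by blast
    from rel_ideal_add[OF this] show "p + q \<in> ?P"
      by (intro CollectI exI[of _ "b + c"]) (simp add: algebra_simps)
  next
    fix p q assume "p \<in> ?P"
    then obtain b where "p - b * (freeX - scal lam) \<in> rel_ideal h" by blast
    from rel_ideal_lmult[OF this, of q] show "q * p \<in> ?P"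
      by (intro CollectI exI[of _ "q * b"]) (simp add: algebra_simps)
  qed
  then obtain g where g: "p - poly_at freeY g \<in> ?P"
    using Ah_left_ideal.cong_poly_at_Y by blast
  then obtain b where b: "p - poly_at freeY g - b * (freeX - scal lam) \<in> rel_ideal h" by blast
  then have "p - poly_at freeY g \<in> J"
    using add[OF subsetD[OF rel b] lmult[OF root, of b]] by simp
  from diff[OF p this] have "g = 0" using poly_at_Y_in_imp_zero[OF assms] by simp
  with b show "\<exists>b. p - b * (freeX - scal lam) \<in> rel_ideal h" by auto
next
  assume "\<exists>b. p - b * (freeX - scal lam) \<in> rel_ideal h"
  then obtain b where "p - b * (freeX - scal lam) \<in> rel_ideal h" ..
  then show "p \<in> J" using add[OF subsetD[OF rel] lmult[OF root, of b]] by fastforce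
qed

section \<open>Cyclic modules\<close>

context left_module
begin

lemma smult_l_null: "v \<in> carrier M \<Longrightarrow> \<zero>\<^bsub>R\<^esub> \<odot>\<^bsub>M\<^esub> v = \<zero>\<^bsub>M\<^esub>"
  by (metis M.add.l_cancel_one' R.r_zero R.zero_closed smult_closed smult_l_distr)

lemma smult_r_null: "a \<in> carrier R \<Longrightarrow> a \<odot>\<^bsub>M\<^esub> \<zero>\<^bsub>M\<^esub> = \<zero>\<^bsub>M\<^esub>"
  by (metis M.add.l_cancel_one' M.r_zero M.zero_closed smult_closed smult_r_distr)

lemma smult_l_minus:
  assumes "a \<in> carrier R" "v \<in> carrier M"
  shows "(\<ominus>\<^bsub>R\<^esub> a) \<odot>\<^bsub>M\<^esub> v = \<ominus>\<^bsub>M\<^esub> (a \<odot>\<^bsub>M\<^esub> v)"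
proof -
  have "(\<ominus>\<^bsub>R\<^esub> a) \<odot>\<^bsub>M\<^esub> v \<oplus>\<^bsub>M\<^esub> a \<odot>\<^bsub>M\<^esub> v = (\<ominus>\<^bsub>R\<^esub> a \<oplus>\<^bsub>R\<^esub> a) \<odot>\<^bsub>M\<^esub> v"
    by (rule smult_l_distr[symmetric]) (use assms in auto)
  also have "\<dots> = \<zero>\<^bsub>M\<^esub>" using assms by (simp add: R.l_neg smult_l_null)
  finally show ?thesis
    using M.minus_equality[of "(\<ominus>\<^bsub>R\<^esub> a) \<odot>\<^bsub>M\<^esub> v" "a \<odot>\<^bsub>M\<^esub> v"] assms smult_closed by simp
qed

lemma smult_eq_iff:
  assumes "a \<in> carrier R" "b \<in> carrier R" "v \<in> carrier M"
  shows "a \<odot>\<^bsub>M\<^esub> v = b \<odot>\<^bsub>M\<^esub> v \<longleftrightarrow> (a \<ominus>\<^bsub>R\<^esub> b) \<odot>\<^bsub>M\<^esub> v = \<zero>\<^bsub>M\<^esub>"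
proof -
  have "x \<oplus>\<^bsub>M\<^esub> \<ominus>\<^bsub>M\<^esub> y = \<zero>\<^bsub>M\<^esub> \<longleftrightarrow> x = y" if "x \<in> carrier M" "y \<in> carrier M" for x y
    using that by (metis M.a_inv_closed M.minus_equality M.minus_minus M.r_neg)
  then show ?thesis
    using assms by (simp add: R.minus_eq smult_l_distr smult_l_minus smult_closed)
qed

lemma orbit_submodule:
  assumes u: "u \<in> carrier M"
  shows "submodule ((\<lambda>a. a \<odot>\<^bsub>M\<^esub> u) ` carrier R) R M"
proof (intro submodule.intro submodule_axioms.intro M.add.subgroupI)
  fix x assume "x \<in> (\<lambda>a. a \<odot>\<^bsub>M\<^esub> u) ` carrier R"
  then show "\<ominus>\<^bsub>M\<^esub> x \<in> (\<lambda>a. a \<odot>\<^bsub>M\<^esub> u) ` carrier R"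
    using u by (auto simp: smult_l_minus[symmetric])
next
  fix x y assume "x \<in> (\<lambda>a. a \<odot>\<^bsub>M\<^esub> u) ` carrier R" "y \<in> (\<lambda>a. a \<odot>\<^bsub>M\<^esub> u) ` carrier R"
  then show "x \<oplus>\<^bsub>M\<^esub> y \<in> (\<lambda>a. a \<odot>\<^bsub>M\<^esub> u) ` carrier R"
    using u by (auto simp: smult_l_distr[symmetric])
next
  fix a x assume "a \<in> carrier R" "x \<in> (\<lambda>a. a \<odot>\<^bsub>M\<^esub> u) ` carrier R"
  then show "a \<odot>\<^bsub>M\<^esub> x \<in> (\<lambda>a. a \<odot>\<^bsub>M\<^esub> u) ` carrier R"
    using u by (auto simp: smult_assoc[symmetric])
qed (use u in \<open>auto intro: smult_closed\<close>)

end

lemma irreducible_module_orbit: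
  assumes "irreducible_module A M" "u \<in> carrier M" "u \<noteq> \<zero>\<^bsub>M\<^esub>"
  shows "carrier M = (\<lambda>a. a \<odot>\<^bsub>M\<^esub> u) ` carrier A"
proof -
  interpret left_module A M using assms(1) by (simp add: irreducible_module_def)
  have "u \<in> (\<lambda>a. a \<odot>\<^bsub>M\<^esub> u) ` carrier A"
    using assms(2) by (intro image_eqI[of _ _ "\<one>\<^bsub>A\<^esub>"]) (simp_all add: smult_one)
  then show ?thesis
    using assms orbit_submodule[OF assms(2)] unfolding irreducible_module_def by blast
qed

lemma module_iso_cyclic:
  assumes M: "left_module A M" and N: "left_module A N"
    and u: "u \<in> carrier M" and w: "w \<in> carrier N"
    and cM: "carrier M = (\<lambda>a. a \<odot>\<^bsub>M\<^esub> u) ` carrier A"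
    and cN: "carrier N = (\<lambda>a. a \<odot>\<^bsub>N\<^esub> w) ` carrier A"
    and ann: "\<And>a. a \<in> carrier A \<Longrightarrow> a \<odot>\<^bsub>M\<^esub> u = \<zero>\<^bsub>M\<^esub> \<longleftrightarrow> a \<odot>\<^bsub>N\<^esub> w = \<zero>\<^bsub>N\<^esub>"
  shows "module_iso A M N"
proof -
  interpret M: left_module A M by (rule M)
  interpret N: left_module A N by (rule N)
  have eq: "a \<odot>\<^bsub>M\<^esub> u = b \<odot>\<^bsub>M\<^esub> u \<longleftrightarrow> a \<odot>\<^bsub>N\<^esub> w = b \<odot>\<^bsub>N\<^esub> w" if "a \<in> carrier A" "b \<in> carrier A" for a b
    using that ann[of "a \<ominus>\<^bsub>A\<^esub> b"] by (simp add: M.smult_eq_iff N.smult_eq_iff u w)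
  define \<phi> where "\<phi> v = (SOME a. a \<in> carrier A \<and> a \<odot>\<^bsub>M\<^esub> u = v) \<odot>\<^bsub>N\<^esub> w" for v
  have \<phi>: "\<phi> (a \<odot>\<^bsub>M\<^esub> u) = a \<odot>\<^bsub>N\<^esub> w" if a: "a \<in> carrier A" for a
  proof -
    let ?b = "SOME b. b \<in> carrier A \<and> b \<odot>\<^bsub>M\<^esub> u = a \<odot>\<^bsub>M\<^esub> u"
    have "?b \<in> carrier A \<and> ?b \<odot>\<^bsub>M\<^esub> u = a \<odot>\<^bsub>M\<^esub> u" by (rule someI[of _ a]) (use a in simp)
    then show ?thesis unfolding \<phi>_def using eq a by blast
  qed
  show ?thesis unfolding module_iso_def
  proof (intro exI conjI ballI)
    show "bij_betw \<phi> (carrier M) (carrier N)"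
      unfolding bij_betw_def inj_on_def by (auto simp: cM cN \<phi> eq image_image)
    show "\<phi> (x \<oplus>\<^bsub>M\<^esub> y) = \<phi> x \<oplus>\<^bsub>N\<^esub> \<phi> y" if "x \<in> carrier M" "y \<in> carrier M" for x y
      using that u w by (auto simp: cM \<phi> M.smult_l_distr[symmetric] N.smult_l_distr[symmetric])
    show "\<phi> (a \<odot>\<^bsub>M\<^esub> x) = a \<odot>\<^bsub>N\<^esub> \<phi> x" if "a \<in> carrier A" "x \<in> carrier M" for a x
      using that u w by (auto simp: cM \<phi> M.smult_assoc[symmetric] N.smult_assoc[symmetric])
  qed
qed

section \<open>Modules over \<open>A\<^sub>h\<close> with an eigenvector of \<open>x\<close>\<close>

locale Ah_module = left_module "Ah h" V
  for h :: "'a::field poly" and V :: "('a Ah_elt, 'v, 'y) module_scheme"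
begin

definition act :: "'a free_alg \<Rightarrow> 'v \<Rightarrow> 'v" where
  "act p v = Ah_of_free h p \<odot>\<^bsub>V\<^esub> v"

lemma of_free_closed: "Ah_of_free h p \<in> carrier (Ah h)"
  by (simp add: carrier_Ah)

lemma act_closed: "v \<in> carrier V \<Longrightarrow> act p v \<in> carrier V"
  by (simp add: act_def smult_closed of_free_closed)

lemma act_add: "v \<in> carrier V \<Longrightarrow> act (p + q) v = act p v \<oplus>\<^bsub>V\<^esub> act q v"
  by (simp add: act_def Ah_hom(2)[symmetric] smult_l_distr of_free_closed)

lemma act_mult: "v \<in> carrier V \<Longrightarrow> act (p * q) v = act p (act q v)"
  by (simp add: act_def Ah_hom(1)[symmetric] smult_assoc of_free_closed)

lemma act_one: "v \<in> carrier V \<Longrightarrow> act 1 v = v"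
  by (simp add: act_def Ah_hom(3)[symmetric] smult_one)

lemma act_zero: "act p \<zero>\<^bsub>V\<^esub> = \<zero>\<^bsub>V\<^esub>"
  by (simp add: act_def of_free_closed smult_r_null)

lemma act_rel: "p \<in> rel_ideal h \<Longrightarrow> v \<in> carrier V \<Longrightarrow> act p v = \<zero>\<^bsub>V\<^esub>"
  using Ah_of_free_eq_iff[of h p 0] by (simp add: act_def Ah_hom(4)[symmetric] smult_l_null)

definition ann :: "'v \<Rightarrow> 'a free_alg set" where
  "ann v = {p. act p v = \<zero>\<^bsub>V\<^esub>}"

lemma ann_left_ideal:
  assumes "u \<in> carrier V" "act (freeX - scal lam) u = \<zero>\<^bsub>V\<^esub>"
  shows "Ah_left_ideal h lam (ann u)"
  using assms by unfold_locales (auto simp: ann_def act_rel act_add act_mult act_zero)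

lemma one_in_ann_iff: "u \<in> carrier V \<Longrightarrow> 1 \<in> ann u \<longleftrightarrow> u = \<zero>\<^bsub>V\<^esub>"
  by (simp add: ann_def act_one)

lemma poly_at_Y_eigenvector:
  fixes k :: "'a poly"
  assumes alg_closed: "\<And>p :: 'a poly. Polynomial.degree p > 0 \<Longrightarrow> \<exists>x. poly p x = 0"
    and u: "u \<in> carrier V" "u \<noteq> \<zero>\<^bsub>V\<^esub>" "act (freeX - scal lam) u = \<zero>\<^bsub>V\<^esub>"
    and h: "poly h lam = 0"
  shows "k \<noteq> 0 \<Longrightarrow> act (poly_at freeY k) u = \<zero>\<^bsub>V\<^esub> \<Longrightarrow>
    \<exists>w mu. w \<in> carrier V \<and> w \<noteq> \<zero>\<^bsub>V\<^esub> \<and> act (freeX - scal lam) w = \<zero>\<^bsub>V\<^esub> \<and> act (freeY - scal mu) w = \<zero>\<^bsub>V\<^esub>"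
proof (induction "Polynomial.degree k" arbitrary: k)
  case 0
  interpret Ah_left_ideal h lam "ann u" by (rule ann_left_ideal) (use u in auto)
  from 0 obtain a where k: "k = [:a:]" by (auto elim: degree_eq_zeroE)
  then have "a = 0" using 0 scal_in[of a] u by (simp add: one_in_ann_iff) (simp add: ann_def)
  with k 0 show ?case by simp
next
  case (Suc n)
  interpret Ah_left_ideal h lam "ann u" by (rule ann_left_ideal) (use u in auto)
  obtain r where "poly k r = 0" using alg_closed[of k] Suc(2) by auto
  then obtain q where q: "k = [:- r, 1:] * q" by (auto simp: poly_eq_0_iff_dvd)
  with Suc(3) have q0: "q \<noteq> 0" by auto
  then have "Polynomial.degree k = Suc (Polynomial.degree q)"
    unfolding q by (subst degree_mult_eq) auto
  then have dq: "n = Polynomial.degree q" using Suc(2) by simp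
  let ?w = "act (poly_at freeY q) u"
  show ?case
  proof (cases "?w = \<zero>\<^bsub>V\<^esub>")
    case True
    with Suc(1)[OF dq q0] show ?thesis by blast
  next
    case False
    have "poly_at freeY k = (freeY - scal r) * poly_at freeY q"
      by (simp only: q poly_at_mult) (simp add: single_uminus)
    then have "act (freeY - scal r) ?w = \<zero>\<^bsub>V\<^esub>" using Suc(4) u by (simp add: act_mult[symmetric])
    moreover have "act (freeX - scal lam) ?w = \<zero>\<^bsub>V\<^esub>"
      using root_poly_at_Y[OF h, of q] u by (simp add: ann_def act_mult)
    ultimately show ?thesis using False u act_closed by blast
  qed
qed

lemma irreducible_orbit:
  assumes "irreducible_module (Ah h) V" "u \<in> carrier V" "u \<noteq> \<zero>\<^bsub>V\<^esub>"
  shows "carrier V = range (\<lambda>p. act p u)"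
  using irreducible_module_orbit[OF assms] by (simp add: carrier_Ah image_image act_def)

lemma irreducible_common_eigenvector:
  assumes irr: "irreducible_module (Ah h) V"
    and alg_closed: "\<And>p :: 'a poly. Polynomial.degree p > 0 \<Longrightarrow> \<exists>x. poly p x = 0"
    and u: "u \<in> carrier V" "u \<noteq> \<zero>\<^bsub>V\<^esub>" "act (freeX - scal lam) u = \<zero>\<^bsub>V\<^esub>"
    and h: "poly h lam = 0"
  obtains w mu where "w \<in> carrier V" "w \<noteq> \<zero>\<^bsub>V\<^esub>" "act (freeX - scal lam) w = \<zero>\<^bsub>V\<^esub>"
    "act (freeY - scal mu) w = \<zero>\<^bsub>V\<^esub>"
proof (cases "act freeY u = \<zero>\<^bsub>V\<^esub>")
  case True
  with u that[of u 0] show ?thesis by simp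
next
  case False
  let ?v = "act freeY u"
  interpret U: Ah_left_ideal h lam "ann u" by (rule ann_left_ideal) (use u in auto)
  have v: "?v \<in> carrier V" using u act_closed by blast
  have "act (freeX - scal lam) ?v = \<zero>\<^bsub>V\<^esub>"
    using U.root_poly_at_Y[OF h, of "[:0,1:]"] u by (simp add: ann_def act_mult)
  then interpret W: Ah_left_ideal h lam "ann ?v" by (rule ann_left_ideal[OF v])
  obtain p where p: "act p ?v = u"
    using irreducible_orbit[OF irr v False] u by (metis imageE)
  obtain g where g: "p - poly_at freeY g \<in> ann ?v" using W.cong_poly_at_Y by blast
  have "(p - poly_at freeY g) * freeY \<in> ann u" using g u by (simp add: ann_def act_mult)
  moreover have "1 - p * freeY \<in> ann u"
  proof -
    have "act (1 - p * freeY) u \<oplus>\<^bsub>V\<^esub> act (p * freeY) u = act (p * freeY) u"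
      using act_add[OF u(1), of "1 - p * freeY" "p * freeY"] p u by (simp add: act_one act_mult)
    then show ?thesis using u act_closed by (simp add: ann_def)
  qed
  ultimately have "1 - poly_at freeY (g * [:0,1:]) \<in> ann u"
    unfolding poly_at_mult by (auto dest: U.add simp: algebra_simps)
  then have "act (poly_at freeY (1 - g * [:0,1:])) u = \<zero>\<^bsub>V\<^esub>" by (simp add: ann_def poly_at_diff)
  moreover have "1 - g * [:0,1:] \<noteq> 0"
  proof
    assume "1 - g * [:0,1:] = 0"
    then have "poly (1 - g * [:0,1:]) 0 = 0" by simp
    then show False by simp
  qed
  ultimately show ?thesis using poly_at_Y_eigenvector[OF alg_closed u h] that by blast
qed

lemma irreducible_iso_one_dim:
  assumes irr: "irreducible_module (Ah h) V"
    and w: "w \<in> carrier V" "w \<noteq> \<zero>\<^bsub>V\<^esub>" "act (freeX - scal lam) w = \<zero>\<^bsub>V\<^esub>"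
      "act (freeY - scal mu) w = \<zero>\<^bsub>V\<^esub>"
    and h: "poly h lam = 0"
  shows "module_iso (Ah h) V (one_dim_module lam mu)"
proof (rule module_iso_cyclic)
  interpret Ah_left_ideal h lam "ann w" by (rule ann_left_ideal) (use w in auto)
  let ?N = "one_dim_module lam mu"
  have sel: "carrier ?N = UNIV" "\<zero>\<^bsub>?N\<^esub> = 0"
    by (simp_all add: one_dim_module_def ring.defs module.defs ring_of_type_algebra_def)
  show "left_module (Ah h) V" by (rule left_module_axioms)
  show "left_module (Ah h) ?N" by (rule left_module_one_dim[OF h])
  show "w \<in> carrier V" by fact
  show "1 \<in> carrier ?N" by (simp add: sel)
  show "carrier V = (\<lambda>a. a \<odot>\<^bsub>V\<^esub> w) ` carrier (Ah h)" by (rule irreducible_module_orbit[OF irr w(1,2)])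
  have "c \<in> range (free_eval lam mu)" for c
    by (rule range_eqI[of _ _ "scal c"]) (simp add: free_eval_single zero_word_def)
  then show "carrier ?N = (\<lambda>a. a \<odot>\<^bsub>?N\<^esub> 1) ` carrier (Ah h)"
    by (auto simp: sel carrier_Ah image_image one_dim_smult[OF h])
  fix a assume "a \<in> carrier (Ah h)"
  then obtain p where a: "a = Ah_of_free h p" by (auto simp: carrier_Ah)
  have e: "p - scal (free_eval lam mu p) \<in> ann w"
    by (rule cong_free_eval) (use w in \<open>simp add: ann_def\<close>)
  have "p \<in> ann w \<longleftrightarrow> free_eval lam mu p = 0"
  proof
    assume "p \<in> ann w"
    from diff[OF this e] show "free_eval lam mu p = 0"
      using scal_in w by (simp add: one_in_ann_iff)
  qed (use e in simp)
  then show "a \<odot>\<^bsub>V\<^esub> w = \<zero>\<^bsub>V\<^esub> \<longleftrightarrow> a \<odot>\<^bsub>?N\<^esub> 1 = \<zero>\<^bsub>?N\<^esub>"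
    by (simp add: a one_dim_smult[OF h] sel ann_def act_def)
qed

end

section \<open>Induced modules\<close>

locale tensor_product = A: ring A + N: left_module R N
  for A :: "('b, 'x) ring_scheme" and R :: "('r, 'y) ring_scheme" and N :: "('r, 'n, 'z) module_scheme"
    and \<phi> :: "'r \<Rightarrow> 'b" +
  assumes hom_closed: "\<phi> \<in> carrier R \<rightarrow> carrier A"
begin

abbreviation G where "G \<equiv> tensor_free A N"
abbreviation H where "H \<equiv> tensor_null A R \<phi> N"
abbreviation U where "U \<equiv> induced_module A R \<phi> N"

lemma carrier_G: "carrier G = {z. Poly_Mapping.keys z \<subseteq> carrier A \<times> carrier N}"
  and mult_G: "x \<otimes>\<^bsub>G\<^esub> y = x + y"
  and one_G: "\<one>\<^bsub>G\<^esub> = 0"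
  by (auto simp: tensor_free_def free_Abelian_group_def)

interpretation G: comm_group G
  unfolding tensor_free_def by (rule abelian_free_Abelian_group)

lemma frag_closed: "a \<in> carrier A \<Longrightarrow> n \<in> carrier N \<Longrightarrow> frag_of (a, n) \<in> carrier G"
  by (simp add: carrier_G)

lemma inv_G: "x \<in> carrier G \<Longrightarrow> inv\<^bsub>G\<^esub> x = - x"
  by (simp add: tensor_free_def)

lemma G_diff: "u \<in> carrier G \<Longrightarrow> v \<in> carrier G \<Longrightarrow> u - v \<in> carrier G"
  using G.m_closed[of u "inv\<^bsub>G\<^esub> v"] G.inv_closed[of v] by (simp add: inv_G mult_G)

lemma rels_subset: "tensor_rels A R \<phi> N \<subseteq> carrier G"
  using hom_closed unfolding tensor_rels_def
  by (auto intro!: G_diff frag_closed N.smult_closed simp: Pi_iff)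

lemma H_subgroup: "subgroup H G"
  unfolding tensor_null_def by (rule G.generate_is_subgroup[OF rels_subset])

lemma H_0: "0 \<in> H"
  using subgroup.one_closed[OF H_subgroup] by (simp add: one_G)

lemma H_diff: "u \<in> H \<Longrightarrow> v \<in> H \<Longrightarrow> u - v \<in> H"
  using subgroup.m_closed[OF H_subgroup, of u "- v"] subgroup.m_inv_closed[OF H_subgroup, of v]
    subgroup.mem_carrier[OF H_subgroup, of v]
  by (simp add: inv_G mult_G)

lemma
  assumes "a \<in> carrier A" "n \<in> carrier N"
  shows H_add_left: "b \<in> carrier A \<Longrightarrow> frag_of (a \<oplus>\<^bsub>A\<^esub> b, n) - frag_of (a, n) - frag_of (b, n) \<in> H"
    and H_add_right: "n' \<in> carrier N \<Longrightarrow> frag_of (a, n \<oplus>\<^bsub>N\<^esub> n') - frag_of (a, n) - frag_of (a, n') \<in> H"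
    and H_middle: "r \<in> carrier R \<Longrightarrow> frag_of (a \<otimes>\<^bsub>A\<^esub> \<phi> r, n) - frag_of (a, r \<odot>\<^bsub>N\<^esub> n) \<in> H"
  unfolding tensor_null_def tensor_rels_def using assms by (auto intro!: generate.incl)

lemma H_zero_left: "n \<in> carrier N \<Longrightarrow> frag_of (\<zero>\<^bsub>A\<^esub>, n) \<in> H"
  using H_diff[OF H_0 H_add_left[of "\<zero>\<^bsub>A\<^esub>" n "\<zero>\<^bsub>A\<^esub>"]] by simp

lemma H_zero_right: "a \<in> carrier A \<Longrightarrow> frag_of (a, \<zero>\<^bsub>N\<^esub>) \<in> H"
  using H_diff[OF H_0 H_add_right[of a "\<zero>\<^bsub>N\<^esub>" "\<zero>\<^bsub>N\<^esub>"]] by simp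

lemma coset_eq_iff:
  assumes "u \<in> carrier G" "v \<in> carrier G"
  shows "H #>\<^bsub>G\<^esub> u = H #>\<^bsub>G\<^esub> v \<longleftrightarrow> u - v \<in> H"
proof
  assume "H #>\<^bsub>G\<^esub> u = H #>\<^bsub>G\<^esub> v"
  then have "u \<in> H #>\<^bsub>G\<^esub> v" using G.rcos_self[OF assms(1) H_subgroup] by simp
  then show "u - v \<in> H" by (auto simp: r_coset_def mult_G)
next
  assume "u - v \<in> H"
  then have "u \<in> H #>\<^bsub>G\<^esub> v" by (force simp: r_coset_def mult_G)
  then show "H #>\<^bsub>G\<^esub> u = H #>\<^bsub>G\<^esub> v" using G.repr_independence H_subgroup assms by metis
qed

definition tensor :: "'b \<Rightarrow> 'n \<Rightarrow> ('b \<times> 'n \<Rightarrow>\<^sub>0 int) set" where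
  "tensor a n = H #>\<^bsub>G\<^esub> frag_of (a, n)"

lemma carrier_U: "carrier U = (\<lambda>z. H #>\<^bsub>G\<^esub> z) ` carrier G"
  by (auto simp: induced_module_def Let_def FactGroup_def RCOSETS_def)

lemma zero_U: "\<zero>\<^bsub>U\<^esub> = H #>\<^bsub>G\<^esub> 0"
  using G.coset_mult_one[OF subgroup.subset[OF H_subgroup]]
  by (simp add: induced_module_def Let_def FactGroup_def one_G)

lemma tensor_closed: "a \<in> carrier A \<Longrightarrow> n \<in> carrier N \<Longrightarrow> tensor a n \<in> carrier U"
  by (auto simp: tensor_def carrier_U intro: frag_closed)

lemma tensor_eq_zero_iff:
  "a \<in> carrier A \<Longrightarrow> n \<in> carrier N \<Longrightarrow> tensor a n = \<zero>\<^bsub>U\<^esub> \<longleftrightarrow> frag_of (a, n) \<in> H"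
  using coset_eq_iff[OF frag_closed, of a n 0] G.one_closed by (simp add: tensor_def zero_U one_G)

lemma U_module: "left_module A U"
  by (rule left_module_induced[OF A.ring_axioms N.left_module_axioms hom_closed])

text \<open>The product is a coset by \<open>left_module_induced\<close>, so it equals any coset contained in it.\<close>

lemma smult_tensor:
  assumes a: "a \<in> carrier A" and b: "b \<in> carrier A" and n: "n \<in> carrier N"
  shows "a \<odot>\<^bsub>U\<^esub> tensor b n = tensor (a \<otimes>\<^bsub>A\<^esub> b) n"
proof -
  have fc: "frag_of (a \<otimes>\<^bsub>A\<^esub> b, n) \<in> carrier G" using a b n by (intro frag_closed) auto
  have "frag_of (b, n) \<in> tensor b n"
    unfolding tensor_def by (rule G.rcos_self[OF frag_closed[OF b n] H_subgroup])
  then have "tensor (a \<otimes>\<^bsub>A\<^esub> b) n \<subseteq> a \<odot>\<^bsub>U\<^esub> tensor b n"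
    by (force simp: induced_module_def Let_def tensor_def)
  then have mem: "frag_of (a \<otimes>\<^bsub>A\<^esub> b, n) \<in> a \<odot>\<^bsub>U\<^esub> tensor b n"
    using G.rcos_self[OF fc H_subgroup] by (auto simp: tensor_def)
  obtain z where z: "z \<in> carrier G" "a \<odot>\<^bsub>U\<^esub> tensor b n = H #>\<^bsub>G\<^esub> z"
    using left_module.smult_closed[OF U_module a tensor_closed[OF b n]] by (auto simp: carrier_U)
  with mem show ?thesis
    using G.repr_independence[OF _ z(1) H_subgroup] by (simp add: tensor_def)
qed

lemma carrier_U_cyclic:
  assumes n0: "n0 \<in> carrier N" and cyc: "carrier N = (\<lambda>r. r \<odot>\<^bsub>N\<^esub> n0) ` carrier R"
  shows "carrier U = (\<lambda>a. tensor a n0) ` carrier A"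
proof -
  have *: "\<exists>a\<in>carrier A. z - frag_of (a, n0) \<in> H" if "Poly_Mapping.keys z \<subseteq> carrier A \<times> carrier N" for z
    using that
  proof (induction rule: frag_induct_on[consumes 1, case_names zero frag diff])
    case zero
    show ?case using H_diff[OF H_0 H_zero_left[OF n0]] by auto
  next
    case (frag s)
    then obtain a r where s: "s = (a, r \<odot>\<^bsub>N\<^esub> n0)" "a \<in> carrier A" "r \<in> carrier R"
      by (auto simp: cyc)
    have "frag_of s - frag_of (a \<otimes>\<^bsub>A\<^esub> \<phi> r, n0) \<in> H"
      using H_diff[OF H_0 H_middle[OF s(2) n0 s(3)]] by (simp add: s)
    then show ?case using s hom_closed by (auto simp: Pi_iff)
  next
    case (diff u v)
    then obtain a b where ab: "a \<in> carrier A" "u - frag_of (a, n0) \<in> H" "b \<in> carrier A" "v - frag_of (b, n0) \<in> H"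
      by blast
    let ?c = "a \<oplus>\<^bsub>A\<^esub> \<ominus>\<^bsub>A\<^esub> b"
    have "?c \<oplus>\<^bsub>A\<^esub> b = a" using ab by (simp add: A.a_assoc A.l_neg)
    then have "frag_of (a, n0) - frag_of (?c, n0) - frag_of (b, n0) \<in> H"
      using H_add_left[OF _ n0 ab(3), of ?c] ab by simp
    from H_diff[OF H_diff[OF ab(2,4)] H_diff[OF H_0 this]]
    have "u - v - frag_of (?c, n0) \<in> H" by (simp add: algebra_simps)
    then show ?case using ab by (intro bexI[of _ ?c]) auto
  qed
  have "H #>\<^bsub>G\<^esub> z \<in> (\<lambda>a. tensor a n0) ` carrier A" if z: "z \<in> carrier G" for z
  proof -
    obtain a where a: "a \<in> carrier A" "z - frag_of (a, n0) \<in> H"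
      using * z by (auto simp: carrier_G)
    then have "H #>\<^bsub>G\<^esub> z = tensor a n0"
      unfolding tensor_def using coset_eq_iff[OF z frag_closed[OF a(1) n0]] by blast
    with a show ?thesis by blast
  qed
  then show ?thesis using tensor_closed[OF _ n0] unfolding carrier_U by blast
qed

lemma tensor_zero_imp:
  assumes M: "left_module A M"
    and \<theta>: "\<theta> \<in> carrier N \<rightarrow> carrier M"
    and \<theta>_add: "\<And>n n'. n \<in> carrier N \<Longrightarrow> n' \<in> carrier N \<Longrightarrow> \<theta> (n \<oplus>\<^bsub>N\<^esub> n') = \<theta> n \<oplus>\<^bsub>M\<^esub> \<theta> n'"
    and \<theta>_smult: "\<And>r n. r \<in> carrier R \<Longrightarrow> n \<in> carrier N \<Longrightarrow> \<theta> (r \<odot>\<^bsub>N\<^esub> n) = \<phi> r \<odot>\<^bsub>M\<^esub> \<theta> n"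
    and a: "a \<in> carrier A" and n: "n \<in> carrier N" and zero: "tensor a n = \<zero>\<^bsub>U\<^esub>"
  shows "a \<odot>\<^bsub>M\<^esub> \<theta> n = \<zero>\<^bsub>M\<^esub>"
proof -
  interpret M: left_module A M by (rule M)
  let ?f = "\<lambda>(a, n). a \<odot>\<^bsub>M\<^esub> \<theta> n"
  have "?f ` (carrier A \<times> carrier N) \<subseteq> carrier (add_monoid M)"
    using \<theta> by (auto intro!: M.smult_closed)
  then obtain k where k: "k \<in> hom G (add_monoid M)"
    and k_frag: "\<And>x. x \<in> carrier A \<times> carrier N \<Longrightarrow> k (frag_of x) = ?f x"
    unfolding tensor_free_def using comm_group.free_Abelian_group_universal[OF M.M.a_comm_group] by metis
  interpret k: group_hom G "add_monoid M" k
    by unfold_locales (rule k)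
  have k_diff: "k (u - v) = k u \<oplus>\<^bsub>M\<^esub> \<ominus>\<^bsub>M\<^esub> k v" if "u \<in> carrier G" "v \<in> carrier G" for u v
    using that k.hom_mult[of u "- v"] k.hom_inv[of v] G.inv_closed[of v]
    by (simp add: mult_G inv_G a_inv_def)
  have \<theta>c: "\<theta> n \<in> carrier M" if "n \<in> carrier N" for n using that \<theta> by auto
  have \<phi>c: "\<phi> r \<in> carrier A" if "r \<in> carrier R" for r using that hom_closed by auto
  have 3: "x \<oplus>\<^bsub>M\<^esub> y \<oplus>\<^bsub>M\<^esub> \<ominus>\<^bsub>M\<^esub> x \<oplus>\<^bsub>M\<^esub> \<ominus>\<^bsub>M\<^esub> y = \<zero>\<^bsub>M\<^esub>" if "x \<in> carrier M" "y \<in> carrier M" for x y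
    using that by (metis M.M.a_assoc M.M.a_comm M.M.a_inv_closed M.M.add.m_closed M.M.minus_add M.M.r_neg)
  have "tensor_rels A R \<phi> N \<subseteq> kernel G (add_monoid M) k"
    using rels_subset unfolding tensor_rels_def kernel_def
    by (auto simp: k_diff k_frag frag_closed G_diff \<theta>_add \<theta>_smult M.smult_l_distr M.smult_r_distr
        M.smult_assoc M.smult_closed N.smult_closed \<theta>c \<phi>c 3 M.M.r_neg)
  then have "H \<subseteq> kernel G (add_monoid M) k"
    unfolding tensor_null_def using G.generate_subgroup_incl k.subgroup_kernel by blast
  then show ?thesis
    using zero k_frag[of "(a, n)"] a n by (auto simp: tensor_eq_zero_iff kernel_def)
qed

end

lemma module_iso_induced_principal:
  fixes A :: "('b, 'x) ring_scheme" and R :: "('r, 'y) ring_scheme"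
  assumes M: "left_module A M" and R: "cring R" and \<phi>: "\<phi> \<in> ring_hom R A" and f: "f \<in> carrier R"
    and u: "u \<in> carrier M" and cM: "carrier M = (\<lambda>a. a \<odot>\<^bsub>M\<^esub> u) ` carrier A"
    and ann: "\<And>a. a \<in> carrier A \<Longrightarrow> a \<odot>\<^bsub>M\<^esub> u = \<zero>\<^bsub>M\<^esub> \<longleftrightarrow> (\<exists>b\<in>carrier A. a = b \<otimes>\<^bsub>A\<^esub> \<phi> f)"
  shows "module_iso A M (induced_module A R \<phi> (quotient_module R (PIdl\<^bsub>R\<^esub> f)))"
proof -
  interpret M: left_module A M by (rule M)
  interpret R: cring R by (rule R)
  define I where "I = PIdl\<^bsub>R\<^esub> f"
  interpret I: ideal I R unfolding I_def by (rule R.cgenideal_ideal[OF f])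
  define N where "N = quotient_module R I"
  have sel: "carrier N = (\<lambda>r. I +>\<^bsub>R\<^esub> r) ` carrier R" "\<zero>\<^bsub>N\<^esub> = I"
      "r \<odot>\<^bsub>N\<^esub> c = (I +>\<^bsub>R\<^esub> r) \<otimes>\<^bsub>R Quot I\<^esub> c" "x \<oplus>\<^bsub>N\<^esub> y = x \<oplus>\<^bsub>R Quot I\<^esub> y" for r c x y
    by (auto simp: N_def quotient_module_def ring.defs module.defs FactRing_def A_RCOSETS_def')
  have N_add: "(I +>\<^bsub>R\<^esub> r) \<oplus>\<^bsub>N\<^esub> (I +>\<^bsub>R\<^esub> s) = I +>\<^bsub>R\<^esub> (r \<oplus>\<^bsub>R\<^esub> s)"
    and N_smult: "r \<odot>\<^bsub>N\<^esub> (I +>\<^bsub>R\<^esub> s) = I +>\<^bsub>R\<^esub> (r \<otimes>\<^bsub>R\<^esub> s)" if "r \<in> carrier R" "s \<in> carrier R" for r s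
    using ring_hom_add[OF I.rcos_ring_hom that] ring_hom_mult[OF I.rcos_ring_hom that] by (simp_all add: sel)
  interpret tensor_product A R N \<phi>
    by (intro tensor_product.intro M.R.ring_axioms tensor_product_axioms.intro)
      (use left_module_quotient[OF I.ideal_axioms] ring_hom_closed[OF \<phi>] in \<open>auto simp: N_def\<close>)
  define n0 where "n0 = I +>\<^bsub>R\<^esub> \<one>\<^bsub>R\<^esub>"
  have n0: "n0 \<in> carrier N" by (auto simp: n0_def sel)
  have N_n0: "r \<odot>\<^bsub>N\<^esub> n0 = I +>\<^bsub>R\<^esub> r" if "r \<in> carrier R" for r
    using that by (simp add: n0_def N_smult)
  then have cyc: "carrier N = (\<lambda>r. r \<odot>\<^bsub>N\<^esub> n0) ` carrier R" by (simp add: sel)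
  have fu: "\<phi> f \<odot>\<^bsub>M\<^esub> u = \<zero>\<^bsub>M\<^esub>"
    using ann[of "\<phi> f"] ring_hom_closed[OF \<phi> f] M.R.l_one[of "\<phi> f"] M.R.one_closed by metis
  define \<theta> where "\<theta> c = \<phi> (SOME r. r \<in> carrier R \<and> I +>\<^bsub>R\<^esub> r = c) \<odot>\<^bsub>M\<^esub> u" for c
  have \<phi>I: "\<phi> i \<odot>\<^bsub>M\<^esub> u = \<zero>\<^bsub>M\<^esub>" if "i \<in> I" for i
  proof -
    from that obtain r where "i = r \<otimes>\<^bsub>R\<^esub> f" "r \<in> carrier R"
      unfolding I_def cgenideal_def by blast
    then show ?thesis
      using f u fu by (simp add: ring_hom_mult[OF \<phi>] ring_hom_closed[OF \<phi>] M.smult_assoc M.smult_r_null)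
  qed
  have \<theta>: "\<theta> (I +>\<^bsub>R\<^esub> r) = \<phi> r \<odot>\<^bsub>M\<^esub> u" if r: "r \<in> carrier R" for r
  proof -
    let ?s = "SOME s. s \<in> carrier R \<and> I +>\<^bsub>R\<^esub> s = I +>\<^bsub>R\<^esub> r"
    have s: "?s \<in> carrier R \<and> I +>\<^bsub>R\<^esub> ?s = I +>\<^bsub>R\<^esub> r" by (rule someI[of _ r]) (use r in simp)
    then have "?s \<in> I +>\<^bsub>R\<^esub> r" using I.a_rcos_self by metis
    then obtain i where i: "i \<in> I" "?s = i \<oplus>\<^bsub>R\<^esub> r" by (auto simp: a_r_coset_def')
    then have "\<phi> ?s \<odot>\<^bsub>M\<^esub> u = \<phi> i \<odot>\<^bsub>M\<^esub> u \<oplus>\<^bsub>M\<^esub> \<phi> r \<odot>\<^bsub>M\<^esub> u"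
      using r u I.a_subset by (subst i(2)) (auto simp: ring_hom_add[OF \<phi>] ring_hom_closed[OF \<phi>] M.smult_l_distr)
    then show ?thesis
      using r u i by (simp add: \<theta>_def \<phi>I M.smult_closed ring_hom_closed[OF \<phi>])
  qed
  have smult: "a \<odot>\<^bsub>U\<^esub> tensor \<one>\<^bsub>A\<^esub> n0 = tensor a n0" if "a \<in> carrier A" for a
    using smult_tensor[OF that _ n0, of "\<one>\<^bsub>A\<^esub>"] that by simp
  have zero_iff: "tensor a n0 = \<zero>\<^bsub>U\<^esub> \<longleftrightarrow> a \<odot>\<^bsub>M\<^esub> u = \<zero>\<^bsub>M\<^esub>" if a: "a \<in> carrier A" for a
  proof
    assume "tensor a n0 = \<zero>\<^bsub>U\<^esub>"
    then have "a \<odot>\<^bsub>M\<^esub> \<theta> n0 = \<zero>\<^bsub>M\<^esub>"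
      by (rule tensor_zero_imp[OF M _ _ _ a n0, rotated -1])
        (use u in \<open>auto simp: sel(1) N_add N_smult \<theta> ring_hom_add[OF \<phi>] ring_hom_mult[OF \<phi>]
          ring_hom_closed[OF \<phi>] M.smult_closed M.smult_l_distr M.smult_assoc\<close>)
    then show "a \<odot>\<^bsub>M\<^esub> u = \<zero>\<^bsub>M\<^esub>"
      using u by (simp add: n0_def \<theta> ring_hom_one[OF \<phi>] M.smult_one)
  next
    assume "a \<odot>\<^bsub>M\<^esub> u = \<zero>\<^bsub>M\<^esub>"
    then obtain b where b: "b \<in> carrier A" "a = b \<otimes>\<^bsub>A\<^esub> \<phi> f" using ann a by blast
    have "f \<odot>\<^bsub>N\<^esub> n0 = \<zero>\<^bsub>N\<^esub>"
      unfolding N_n0[OF f] sel(2) using I.a_rcos_const R.cgenideal_self[OF f] by (simp add: I_def)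
    with H_diff[OF H_middle[OF b(1) n0 f] H_diff[OF H_0 H_zero_right[OF b(1)]]]
    show "tensor a n0 = \<zero>\<^bsub>U\<^esub>" using a b n0 by (simp add: tensor_eq_zero_iff)
  qed
  have "module_iso A M U"
    by (rule module_iso_cyclic[OF M U_module u tensor_closed[OF _ n0] cM])
      (use smult zero_iff carrier_U_cyclic[OF n0 cyc] in \<open>auto simp: image_def\<close>)
  then show ?thesis by (simp add: N_def I_def)
qed

section \<open>Irreducible generalized weight modules\<close>

lemma Ah_of_poly_hom: "Ah_of_poly h \<in> ring_hom R_poly (Ah h)"
  by (rule ring_hom_memI)
    (simp_all add: carrier_Ah Ah_hom free_of_poly_eq_poly_at poly_at_mult poly_at_add ring_of_type_algebra_def)

lemma power_in_ideal_power: "f \<in> I \<Longrightarrow> f ^ k \<in> I [^]\<^bsub>ideals_set R_poly\<^esub> (k :: nat)"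
proof (induction k)
  case 0 show ?case by (simp add: nat_pow_def ideals_set_def ring_of_type_algebra_def)
next
  case (Suc k)
  then have "f ^ k \<otimes>\<^bsub>R_poly\<^esub> f \<in> ideal_prod R_poly (I [^]\<^bsub>ideals_set R_poly\<^esub> k) I"
    by (intro ideal_prod.prod) auto
  then show ?case
    by (simp add: nat_pow_def ideals_set_def) (simp add: ring_of_type_algebra_def mult.commute)
qed

lemma monic_irreducible_alg_closed:
  fixes f :: "'a::alg_closed_field poly"
  assumes "Polynomial.lead_coeff f = 1" "Factorial_Ring.irreducible f"
  obtains lam where "f = [:- lam, 1:]"
proof -
  have "Polynomial.degree f \<noteq> 0"
    using assms(2) is_unit_iff_degree[of f] by (auto simp: Factorial_Ring.irreducible_def)
  then obtain lam where "poly f lam = 0" using alg_closed_imp_poly_has_root by blast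
  then obtain q where q: "f = [:- lam, 1:] * q" by (auto simp: poly_eq_0_iff_dvd)
  moreover have "\<not> is_unit [:- lam, 1:]" by (simp add: is_unit_pCons_iff)
  ultimately have "is_unit q" using assms(2) Factorial_Ring.irreducibleD by blast
  then obtain c where c: "q = [:c:]" by (auto simp: is_unit_poly_iff)
  moreover have "c = 1" using assms(1) by (simp add: q c lead_coeff_mult split: if_splits)
  ultimately show ?thesis using that q by simp
qed

lemma (in Ah_module) weight_space_eigenvector:
  assumes v: "v \<in> weight_space h V \<mm>" "v \<noteq> \<zero>\<^bsub>V\<^esub>" and f: "[:- lam, 1:] \<in> \<mm>"
  obtains u where "u \<in> carrier V" "u \<noteq> \<zero>\<^bsub>V\<^esub>" "act (freeX - scal lam) u = \<zero>\<^bsub>V\<^esub>"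
proof -
  let ?f = "[:- lam, 1:]"
  have vV: "v \<in> carrier V" using v by (simp add: weight_space_def)
  obtain k where "\<forall>r \<in> \<mm> [^]\<^bsub>ideals_set R_poly\<^esub> (k :: nat). Ah_of_poly h r \<odot>\<^bsub>V\<^esub> v = \<zero>\<^bsub>V\<^esub>"
    using v by (auto simp: weight_space_def)
  then have k: "act (poly_at freeX (?f ^ k)) v = \<zero>\<^bsub>V\<^esub>"
    using power_in_ideal_power[OF f, of k] by (auto simp: act_def free_of_poly_eq_poly_at)
  define n where "n = (LEAST n. act (poly_at freeX (?f ^ n)) v = \<zero>\<^bsub>V\<^esub>)"
  have n: "act (poly_at freeX (?f ^ n)) v = \<zero>\<^bsub>V\<^esub>"
    unfolding n_def using k by (rule LeastI)
  then have "n \<noteq> 0" using v vV act_one[OF vV] by (cases n) auto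
  then obtain m where m: "n = Suc m" by (cases n) auto
  let ?u = "act (poly_at freeX (?f ^ m)) v"
  have "?u \<noteq> \<zero>\<^bsub>V\<^esub>" using not_less_Least[of m "\<lambda>n. act (poly_at freeX (?f ^ n)) v = \<zero>\<^bsub>V\<^esub>"]
    by (simp add: n_def[symmetric] m)
  moreover have "act (freeX - scal lam) ?u = \<zero>\<^bsub>V\<^esub>"
    using n unfolding m power_Suc poly_at_mult by (simp add: act_mult vV single_uminus)
  ultimately show ?thesis using that act_closed[OF vV] by blast
qed

theorem corollary6p5:
  fixes h f :: "'a::{alg_closed_field, field_char_0} poly"
    and \<mm> :: "'a poly set"
    and V :: "('a Ah_elt, 'v) module"
  assumes "h \<noteq> 0"
    and "Polynomial.lead_coeff f = 1"
    and "Factorial_Ring.irreducible f"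
    and "\<mm> = PIdl\<^bsub>R_poly\<^esub> f"
    and "maximalideal \<mm> R_poly"
    and "irreducible_module (Ah h) V"
    and "generalized_weight_module h V"
    and "carrier V = weight_space h V \<mm>"
  shows "(\<exists>lam. f = [:- lam, 1:] \<and> poly h lam = 0 \<and> (\<exists>mu. module_iso (Ah h) V (one_dim_module lam mu)))
       \<or> (\<not> f dvd h \<and> module_iso (Ah h) V (U_mod h \<mm>))"
proof -
  interpret Ah_module h V
    using assms(6) by (simp add: Ah_module_def irreducible_module_def)
  obtain lam where f: "f = [:- lam, 1:]" using monic_irreducible_alg_closed[OF assms(2,3)] .
  obtain v where v: "v \<in> carrier V" "v \<noteq> \<zero>\<^bsub>V\<^esub>"
    using assms(6) M.zero_closed by (auto simp: irreducible_module_def)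
  have "f \<in> \<mm>"
    unfolding assms(4) by (rule ring.cgenideal_self[OF ring_of_type_algebra_ring]) (simp add: ring_of_type_algebra_def)
  then obtain u where u: "u \<in> carrier V" "u \<noteq> \<zero>\<^bsub>V\<^esub>" "act (freeX - scal lam) u = \<zero>\<^bsub>V\<^esub>"
    using weight_space_eigenvector[of v \<mm> lam] v assms(8) f by blast
  show ?thesis
  proof (cases "poly h lam = 0")
    case True
    then show ?thesis
      using irreducible_common_eigenvector[OF assms(6) alg_closed_imp_poly_has_root u]
        irreducible_iso_one_dim[OF assms(6)] f by metis
  next
    case False
    interpret Ah_left_ideal h lam "ann u" by (rule ann_left_ideal) (use u in auto)
    have poly_at_f: "poly_at freeX f = freeX - scal lam" by (simp add: f single_uminus)
    have "module_iso (Ah h) V (induced_module (Ah h) R_poly (Ah_of_poly h) (quotient_module R_poly (PIdl\<^bsub>R_poly\<^esub> f)))"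
    proof (rule module_iso_induced_principal[OF left_module_axioms cring_from_type_algebra Ah_of_poly_hom _ u(1)])
      show "f \<in> carrier R_poly" by (simp add: ring_of_type_algebra_def)
      show "carrier V = (\<lambda>a. a \<odot>\<^bsub>V\<^esub> u) ` carrier (Ah h)" by (rule irreducible_module_orbit[OF assms(6) u(1,2)])
      fix a assume "a \<in> carrier (Ah h)"
      then obtain p where a: "a = Ah_of_free h p" by (auto simp: carrier_Ah)
      have "a \<odot>\<^bsub>V\<^esub> u = \<zero>\<^bsub>V\<^esub> \<longleftrightarrow> (\<exists>b. p - b * poly_at freeX f \<in> rel_ideal h)"
        using mem_iff_principal[OF False, of p] u by (simp add: one_in_ann_iff poly_at_f) (simp add: ann_def act_def a)
      then show "a \<odot>\<^bsub>V\<^esub> u = \<zero>\<^bsub>V\<^esub> \<longleftrightarrow> (\<exists>b\<in>carrier (Ah h). a = b \<otimes>\<^bsub>Ah h\<^esub> Ah_of_poly h f)"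
        by (simp add: carrier_Ah a Ah_hom free_of_poly_eq_poly_at Ah_of_free_eq_iff)
    qed
    then have "module_iso (Ah h) V (U_mod h \<mm>)" by (simp add: U_mod_def assms(4))
    moreover have "\<not> f dvd h" using False by (simp add: f poly_eq_0_iff_dvd)
    ultimately show ?thesis by blast
  qed
qed

end
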